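(* Let $\alpha\in(0,1)$ be irrational, let $(\Omega_\alpha,S)$ be the Sturmian subshift generated by $\alpha$, let $\mu$ be its unique $S$-invariant probability measure, and let $\zeta=\{[0],[1]\}$. (1) The following are equivalent: (a) the partial quotients (coefficients of the continued fraction expansion) of $\alpha$ are bounded; (b) $\underline{\mathcal{R}}_{\zeta}(x)>0$ for $\mu$-almost every $x$; (c) $\overline{\mathcal{R}}_{\zeta}(x)<\infty$ for $\mu$-almost every $x$. (2) If the partial quotients of $\alpha$ are bounded, then $\underline{\mathcal{R}}_{\zeta}(x)<1$ and $\overline{\mathcal{R}}_{\zeta}(x)>1$ for $\mu$-almost every $x$. (3) Statements (1) and (2) also hold for the rotation $R_\alpha:[0,1)\to[0,1)$, $R_\alpha(t)=t+\alpha \bmod 1$, with Lebesgue measure in place of $\mu$ and with the partition $\zeta=\{[0,1-\alpha),[1-\alpha,1)\}$.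
   Context: Define $R_\alpha(t)=t+\alpha \pmod 1$ on $[0,1)$ and $I_\alpha:[0,1)\to\{0,1\}$ by $I_\alpha(t)=0$ if $t\in[0,1-\alpha)$ and $I_\alpha(t)=1$ otherwise. $\Omega_\alpha$ is the closure in $\{0,1\}^{\mathbb Z}$ (product topology) of $\{(I_\alpha(R_\alpha^n(t)))_{n\in\mathbb Z}: t\in[0,1)\}$, and $S$ is the left shift $(Sx)_n=x_{n+1}$; $(\Omega_\alpha,S)$ is minimal and uniquely ergodic. For a word $u$, $[u]=\{x\in\Omega_\alpha: x_0\cdots x_{|u|-1}=u\}$. For a map $T$ on a probability space and a measurable set $U$, $\tau(U)=\inf\{k\geq 1: T^kU\cap U\neq\emptyset\}$. For a finite measurable partition $\zeta$, $\zeta_n=\zeta\vee T^{-1}\zeta\vee\cdots\vee T^{-n+1}\zeta$, $\zeta_n(x)$ is the atom of $\zeta_n$ containing $x$, and $\underline{\mathcal{R}}_{\zeta}(x)=\liminf_{n\to\infty}\tau(\zeta_n(x))/n$, $\overline{\mathcal{R}}_{\zeta}(x)=\limsup_{n\to\infty}\tau(\zeta_n(x))/n$ (with $T=S$ in (1),(2) and $T=R_\alpha$ in (3)). *)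

theory Defs
  imports "HOL-Probability.Probability"
begin

fun cf_rem :: "real \<Rightarrow> nat \<Rightarrow> real" where
  "cf_rem a 0 = a"
| "cf_rem a (Suc n) = 1 / frac (cf_rem a n)"

definition cf_coeff :: "real \<Rightarrow> nat \<Rightarrow> int" where
  "cf_coeff a n = \<lfloor>cf_rem a n\<rfloor>"

definition bounded_partial_quotients :: "real \<Rightarrow> bool" where
  "bounded_partial_quotients a \<longleftrightarrow> (\<exists>B. \<forall>n. cf_coeff a n \<le> B)"

definition first_return :: "('a \<Rightarrow> 'a) \<Rightarrow> 'a set \<Rightarrow> nat" where
  "first_return T U = Inf {k::nat. k \<ge> 1 \<and> (T ^^ k) ` U \<inter> U \<noteq> {}}"

(* atom of zeta_n = zeta v T^-1 zeta v ... v T^-(n-1) zeta containing x, within space X *)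
definition part_atom :: "('a \<Rightarrow> 'a) \<Rightarrow> 'a set \<Rightarrow> 'a set set \<Rightarrow> nat \<Rightarrow> 'a \<Rightarrow> 'a set" where
  "part_atom T X \<zeta> n x =
     {y \<in> X. \<forall>i<n. \<forall>A\<in>\<zeta>. ((T ^^ i) y \<in> A \<longleftrightarrow> (T ^^ i) x \<in> A)}"

definition lower_rec_rate :: "('a \<Rightarrow> 'a) \<Rightarrow> 'a set \<Rightarrow> 'a set set \<Rightarrow> 'a \<Rightarrow> ereal" where
  "lower_rec_rate T X \<zeta> x =
     liminf (\<lambda>n. ereal (real (first_return T (part_atom T X \<zeta> n x)) / real n))"

definition upper_rec_rate :: "('a \<Rightarrow> 'a) \<Rightarrow> 'a set \<Rightarrow> 'a set set \<Rightarrow> 'a \<Rightarrow> ereal" where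
  "upper_rec_rate T X \<zeta> x =
     limsup (\<lambda>n. ereal (real (first_return T (part_atom T X \<zeta> n x)) / real n))"

definition rot :: "real \<Rightarrow> real \<Rightarrow> real" where
  "rot a t = frac (t + a)"

definition sturm_ind :: "real \<Rightarrow> real \<Rightarrow> nat" where
  "sturm_ind a t = (if t < 1 - a then 0 else 1)"

(* (I_alpha(R_alpha^n t))_{n in Z};  R_alpha^n t = frac (t + n alpha) for all integers n *)
definition sturm_code :: "real \<Rightarrow> real \<Rightarrow> int \<Rightarrow> nat" where
  "sturm_code a t = (\<lambda>n. sturm_ind a (frac (t + of_int n * a)))"

(* closure in the product topology on {0,1}^Z (viewed inside nat^Z, discrete nat) *)
definition sturm_space :: "real \<Rightarrow> (int \<Rightarrow> nat) set" where
  "sturm_space a = closure (sturm_code a ` {0..<1})"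

definition shift :: "(int \<Rightarrow> nat) \<Rightarrow> (int \<Rightarrow> nat)" where
  "shift x = (\<lambda>n. x (n + 1))"

definition sturm_inv_prob :: "real \<Rightarrow> (int \<Rightarrow> nat) measure \<Rightarrow> bool" where
  "sturm_inv_prob a \<mu> \<longleftrightarrow>
     prob_space \<mu> \<and> space \<mu> = sturm_space a \<and>
     sets \<mu> = sets (restrict_space borel (sturm_space a)) \<and>
     shift \<in> measurable \<mu> \<mu> \<and> distr \<mu> \<mu> shift = \<mu>"

definition sturm_partition :: "real \<Rightarrow> (int \<Rightarrow> nat) set set" where
  "sturm_partition a = {{x \<in> sturm_space a. x 0 = 0}, {x \<in> sturm_space a. x 0 = 1}}"

definition rot_partition :: "real \<Rightarrow> real set set" where
  "rot_partition a = {{0..<1 - a}, {1 - a..<1}}"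

end

theory Submission
  imports Defs
begin

text \<open>
  The bounded type condition is equivalent to bad approximability: \<open>k \<cdot> \<parallel>k \<alpha>\<parallel> \<ge> c > 0\<close> for all \<open>k \<ge> 1\<close>.
  An atom of \<open>\<zeta>\<^sub>n\<close> is an interval between neighbouring points \<open>-i \<alpha>\<close> with \<open>i \<le> n\<close>, and its return
  time is the least \<open>k \<ge> 1\<close> for which \<open>\<parallel>k \<alpha>\<parallel>\<close> is smaller than its length. Under bad approximability
  all these lengths are comparable to \<open>1 / n\<close>, so both rates are positive and finite everywhere.

  For the almost everywhere statements take \<open>q\<close> with \<open>\<delta> = \<parallel>q \<alpha>\<parallel>\<close> and let \<open>q'\<close> be the next
  best approximation denominator. The return time of the \<open>n\<close>-atom of \<open>t\<close> is at most \<open>q\<close> unless one of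
  \<open>t, \<dots>, t + n \<alpha>\<close> lies in an arc of length \<open>\<delta>\<close>, and it is at least \<open>q'\<close> if one of
  \<open>t, \<dots>, t + (n - q) \<alpha>\<close> lies in that arc. Counting visits of orbits to arcs bounds the measure of
  both events from below, uniformly over all invariant probabilities. Since the rates do not
  increase along orbits, conditioning an invariant probability on a level set of a rate yields
  another one, so an event that has positive measure for every invariant probability has full
  measure.
\<close>

section \<open>Bounded partial quotients and bad approximability\<close>

definition dist_int :: "real \<Rightarrow> real" where
  "dist_int x = \<bar>x - of_int (round x)\<bar>"

lemma dist_int_le: "dist_int x \<le> \<bar>x - of_int h\<bar>"
  unfolding dist_int_def by (rule round_diff_minimal)

lemma dist_int_nonneg: "0 \<le> dist_int x"
  by (simp add: dist_int_def)

definition badly_approximable :: "real \<Rightarrow> bool" where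
  "badly_approximable a \<longleftrightarrow> (\<exists>c>0. \<forall>k::nat. k \<ge> 1 \<longrightarrow> c \<le> real k * dist_int (real k * a))"

section \<open>Convergents of the continued fraction and their approximation errors\<close>

fun cf_den :: "real \<Rightarrow> nat \<Rightarrow> int" where
  "cf_den a 0 = 0"
| "cf_den a (Suc 0) = 1"
| "cf_den a (Suc (Suc n)) = cf_coeff a (Suc n) * cf_den a (Suc n) + cf_den a n"

fun cf_num :: "real \<Rightarrow> nat \<Rightarrow> int" where
  "cf_num a 0 = 1"
| "cf_num a (Suc 0) = cf_coeff a 0"
| "cf_num a (Suc (Suc n)) = cf_coeff a (Suc n) * cf_num a (Suc n) + cf_num a n"

text \<open>The product equals \<open>\<bar>cf_den a n * a - cf_num a n\<bar>\<close> for irrational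
  \<open>a\<close>. Indices are shifted by one against the usual convergents: the values at
  \<open>0\<close> are those at index -1.\<close>

fun cf_err :: "real \<Rightarrow> nat \<Rightarrow> real" where
  "cf_err a 0 = 1"
| "cf_err a (Suc n) = cf_err a n * frac (cf_rem a n)"

lemma frac_in_Rats_iff: "frac (x::real) \<in> \<rat> \<longleftrightarrow> x \<in> \<rat>"
proof
  assume "frac x \<in> \<rat>"
  then have "frac x + of_int \<lfloor>x\<rfloor> \<in> \<rat>" by (intro Rats_add) auto
  then show "x \<in> \<rat>" by (simp add: frac_def)
qed (simp add: frac_def)

context
  fixes a :: real
  assumes irr: "a \<notin> \<rat>"
begin

lemma cf_rem_irrational: "cf_rem a n \<notin> \<rat>"
proof (induction n)
  case (Suc n)
  then show ?case
    by (metis Rats_inverse cf_rem.simps(2) frac_in_Rats_iff inverse_eq_divide inverse_inverse_eq)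
qed (simp add: irr)

lemma frac_cf_rem_pos: "0 < frac (cf_rem a n)"
  using cf_rem_irrational[of n] Ints_subset_Rats by auto

lemma cf_coeff_ge_1: "1 \<le> cf_coeff a (Suc n)"
  using frac_cf_rem_pos[of n] frac_lt_1[of "cf_rem a n"]
  by (simp add: cf_coeff_def)

lemma cf_err_pos: "0 < cf_err a n"
  by (induction n) (auto simp: frac_cf_rem_pos simp del: frac_gt_0_iff)

lemma cf_err_Suc_Suc: "cf_err a (Suc (Suc n)) = cf_err a n - cf_coeff a (Suc n) * cf_err a (Suc n)"
proof -
  have "frac (cf_rem a n) * frac (1 / frac (cf_rem a n))
      = 1 - frac (cf_rem a n) * \<lfloor>1 / frac (cf_rem a n)\<rfloor>"
    using frac_cf_rem_pos[of n] unfolding frac_def[of "1 / _"] right_diff_distrib by simp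
  then have "cf_err a n * (frac (cf_rem a n) * frac (1 / frac (cf_rem a n)))
      = cf_err a n * (1 - frac (cf_rem a n) * \<lfloor>1 / frac (cf_rem a n)\<rfloor>)" by simp
  then show ?thesis by (simp add: cf_coeff_def algebra_simps)
qed

text \<open>The coefficient enters the recursions of \<open>cf_den\<close> and \<open>cf_err\<close>
  with opposite signs, so it cancels and the sum stays constant. This gives
  \<open>cf_err a n \<le> 1 / cf_den a (Suc n)\<close>.\<close>

lemma cf_den_err: "cf_den a (Suc n) * cf_err a n + cf_den a n * cf_err a (Suc n) = 1"
proof (induction n)
  case (Suc n)
  then show ?case
    unfolding cf_err_Suc_Suc cf_den.simps(3) by (simp add: algebra_simps)
qed simp

lemma cf_den_num_err: "cf_den a n * a - cf_num a n = (-1) ^ Suc n * cf_err a n"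
proof (induction n rule: induct_nat_012)
  case 1
  then show ?case by (simp add: cf_coeff_def frac_def)
next
  case (ge2 n)
  have "cf_den a (Suc (Suc n)) * a - cf_num a (Suc (Suc n))
      = cf_coeff a (Suc n) * (cf_den a (Suc n) * a - cf_num a (Suc n)) + (cf_den a n * a - cf_num a n)"
    by (simp add: algebra_simps)
  also have "\<dots> = (-1) ^ Suc (Suc (Suc n)) * cf_err a (Suc (Suc n))"
    unfolding ge2 cf_err_Suc_Suc by (simp add: algebra_simps)
  finally show ?case .
qed simp

text \<open>The recursion only flips the sign of the determinant. Any common divisor of numerator
  and denominator divides it, which gives coprimality below.\<close>

lemma cf_det: "cf_num a (Suc n) * cf_den a n - cf_num a n * cf_den a (Suc n) = (-1) ^ Suc n"
proof (induction n)
  case (Suc n)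
  have "cf_num a (Suc (Suc n)) * cf_den a (Suc n) - cf_num a (Suc n) * cf_den a (Suc (Suc n))
      = - (cf_num a (Suc n) * cf_den a n - cf_num a n * cf_den a (Suc n))"
    by (simp add: algebra_simps)
  then show ?case unfolding Suc by simp
qed simp

lemma coprime_cf: "coprime (cf_num a n) (cf_den a n)"
proof (rule coprimeI)
  fix d assume "d dvd cf_num a n" "d dvd cf_den a n"
  then have "d dvd cf_num a (Suc n) * cf_den a n - cf_num a n * cf_den a (Suc n)"
    by (intro dvd_diff dvd_mult dvd_mult2)
  then show "is_unit d"
    unfolding cf_det by (metis dvd_minus_iff minus_one_power_iff)
qed

lemma cf_den_nonneg: "0 \<le> cf_den a n \<and> 1 \<le> cf_den a (Suc n)"
proof (induction n)
  case (Suc n)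
  have "1 * cf_den a (Suc n) \<le> cf_coeff a (Suc n) * cf_den a (Suc n)"
    using cf_coeff_ge_1 Suc by (intro mult_right_mono) auto
  then have "cf_den a (Suc n) + cf_den a n \<le> cf_den a (Suc (Suc n))" by simp
  with Suc show ?case by linarith
qed simp

lemma cf_den_add_le: "cf_den a (Suc n) + cf_den a n \<le> cf_den a (Suc (Suc n))"
proof -
  have "1 * cf_den a (Suc n) \<le> cf_coeff a (Suc n) * cf_den a (Suc n)"
    using cf_coeff_ge_1 cf_den_nonneg[of n] by (intro mult_right_mono) auto
  then show ?thesis by simp
qed

lemma cf_den_le_Suc: "cf_den a n \<le> cf_den a (Suc n)"
proof (cases n)
  case (Suc m)
  show ?thesis using cf_den_add_le[of m] cf_den_nonneg[of m] unfolding Suc by linarith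
qed simp

lemma cf_den_ge: "int n \<le> cf_den a (Suc n)"
proof (induction n)
  case (Suc n)
  show ?case
  proof (cases n)
    case 0
    then show ?thesis using cf_den_nonneg[of 1] by simp
  next
    case (Suc m)
    have "1 \<le> cf_den a n" using cf_den_nonneg[of m] unfolding Suc by simp
    then show ?thesis using cf_den_add_le[of n] \<open>int n \<le> _\<close> by linarith
  qed
qed simp

lemma cf_den_err_le: "cf_den a (Suc n) * cf_err a n \<le> 1"
proof -
  have "0 \<le> cf_den a n * cf_err a (Suc n)"
    using cf_den_nonneg[of n] cf_err_pos[of "Suc n"]
    by (intro mult_nonneg_nonneg) (simp_all only: of_int_0_le_iff less_imp_le)
  with cf_den_err[of n] show ?thesis by linarith
qed

text \<open>Any fraction \<open>h / k\<close> is compared with a convergent whose denominator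
  exceeds \<open>k\<close> by a bounded factor only. Their determinant is a nonzero integer, so the
  two fractions cannot be too close.\<close>

lemma bounded_imp_badly_approximable:
  assumes "bounded_partial_quotients a"
  shows "badly_approximable a"
proof -
  obtain B0 where B0: "\<And>n. cf_coeff a n \<le> B0"
    using assms by (auto simp: bounded_partial_quotients_def)
  define B where "B = max B0 1"
  have B: "\<And>n. cf_coeff a n \<le> B" and "B \<ge> 1"
    using B0 by (auto simp: B_def intro: le_max_iff_disj[THEN iffD2])
  have le: "1 / (4 * (real_of_int B + 1)) \<le> real k * dist_int (real k * a)" if "k \<ge> 1" for k :: nat
  proof -
    define h where "h = round (k * a)"
    \<comment> \<open>The threshold \<open>2 * k\<close> makes \<open>k * cf_err a m\<close> at most
      \<open>1/2\<close>; minimality together with the bound \<open>B\<close> keeps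
      \<open>cf_den a m\<close> below \<open>2 * (B + 1) * k\<close>.\<close>
    define m where "m = (LEAST m. 2 * int k \<le> cf_den a m)"
    have "2 * int k \<le> cf_den a (Suc (2 * k))"
      using cf_den_ge[of "2 * k"] by simp
    then have m: "2 * int k \<le> cf_den a m" unfolding m_def by (rule LeastI)
    have m_less: "cf_den a i < 2 * int k" if "i < m" for i
      using not_less_Least[of i] that unfolding m_def by force
    have "m \<noteq> 0" "m \<noteq> Suc 0" using m that by (auto intro!: Nat.gr0I)
    then obtain m' where m': "m = Suc (Suc m')" by (metis not0_implies_Suc)
    have "cf_den a m \<le> B * cf_den a (Suc m') + cf_den a (Suc m')"
    proof -
      have "cf_den a m' \<le> cf_den a (Suc m')" by (rule cf_den_le_Suc)
      moreover have "cf_coeff a (Suc m') * cf_den a (Suc m') \<le> B * cf_den a (Suc m')"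
        using B cf_den_nonneg[of m'] by (intro mult_right_mono) auto
      ultimately show ?thesis by (simp add: m')
    qed
    also have "\<dots> \<le> (B + 1) * (2 * int k)"
    proof -
      have "(B + 1) * cf_den a (Suc m') \<le> (B + 1) * (2 * int k)"
        using m_less[of "Suc m'"] \<open>B \<ge> 1\<close> m' by (intro mult_left_mono) auto
      then show ?thesis by (simp add: algebra_simps)
    qed
    finally have upper: "cf_den a m \<le> (B + 1) * (2 * int k)" .
    have err: "k * cf_err a m \<le> 1/2"
    proof -
      have "cf_den a m \<le> cf_den a (Suc m)" by (rule cf_den_le_Suc)
      then have "2 * real k \<le> cf_den a (Suc m)" using m by linarith
      then have "2 * real k * cf_err a m \<le> cf_den a (Suc m) * cf_err a m"
        using cf_err_pos[of m] by (intro mult_right_mono) auto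
      also have "\<dots> \<le> 1"
        by (rule cf_den_err_le)
      finally show ?thesis by linarith
    qed
    \<comment> \<open>\<open>D\<close> is the determinant of \<open>h / k\<close> and the
      convergent. If it vanished, coprimality would make \<open>cf_den a m\<close> divide
      \<open>k\<close>, although it is at least \<open>2 * k\<close>.\<close>
    define D where "D = int k * cf_num a m - h * cf_den a m"
    have "D \<noteq> 0"
    proof
      assume "D = 0"
      then have "cf_den a m dvd int k * cf_num a m" by (simp add: D_def)
      then have "cf_den a m dvd int k"
        using coprime_dvd_mult_left_iff[of "cf_den a m" "cf_num a m"] coprime_cf[of m]
        by (simp only: coprime_commute[of "cf_den a m"]) 
      then have "cf_den a m \<le> int k" using that by (intro zdvd_imp_le) auto
      then show False using m that by linarith
    qed
    then have "1 \<le> \<bar>real_of_int D\<bar>" by linarith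
    also have "real_of_int D = cf_den a m * (k * a - h) - k * (cf_den a m * a - cf_num a m)"
      by (simp add: D_def algebra_simps)
    also have "\<bar>\<dots>\<bar> \<le> cf_den a m * \<bar>k * a - h\<bar> + k * \<bar>cf_den a m * a - cf_num a m\<bar>"
      using cf_den_nonneg[of m] by (intro order_trans[OF abs_triangle_ineq4]) (simp add: abs_mult)
    also have "\<dots> \<le> cf_den a m * dist_int (k * a) + 1/2"
      using err cf_err_pos[of m] by (simp add: cf_den_num_err abs_mult h_def dist_int_def)
    finally have "1/2 \<le> cf_den a m * dist_int (k * a)" by simp
    also have "\<dots> \<le> ((B + 1) * (2 * int k)) * dist_int (k * a)"
      using upper[folded of_int_le_iff[where 'a = real]]
      by (intro mult_right_mono) (simp_all add: dist_int_nonneg)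
    finally have "1 \<le> k * dist_int (k * a) * (4 * (real_of_int B + 1))" by (simp add: algebra_simps)
    moreover have "0 < 4 * (real_of_int B + 1)" using \<open>B \<ge> 1\<close> by simp
    ultimately show ?thesis by (simp only: pos_divide_le_eq)
  qed
  have "0 < 1 / (4 * (real_of_int B + 1))" using \<open>B \<ge> 1\<close> by simp
  with le show ?thesis unfolding badly_approximable_def
    by (intro exI[of _ "1 / (4 * (real_of_int B + 1))"]) simp
qed

text \<open>At a convergent denominator the constant \<open>c\<close> is at most
  \<open>cf_den a n * cf_err a n\<close>. Multiplied by the coefficient, the right side is still at
  most 1, so the coefficient is at most \<open>1 / c\<close>.\<close>

lemma badly_approximable_imp_bounded:
  assumes "badly_approximable a"
  shows "bounded_partial_quotients a"
proof -
  obtain c where c: "c > 0" "\<And>k::nat. k \<ge> 1 \<Longrightarrow> c \<le> real k * dist_int (real k * a)"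
    using assms by (auto simp: badly_approximable_def)
  \<comment> \<open>The coefficient of index 0 is bounded by itself, because
    \<open>cf_den a 0 = 0\<close> provides no \<open>k \<ge> 1\<close> to test.\<close>
  have "cf_coeff a n \<le> max \<lceil>1 / c\<rceil> (cf_coeff a 0)" for n
  proof (cases n)
    case (Suc m)
    define k where "k = nat (cf_den a n)"
    have k: "real k = cf_den a n" "k \<ge> 1" using cf_den_nonneg[of m] Suc by (auto simp: k_def)
    have "dist_int (k * a) \<le> cf_err a n"
      using dist_int_le[of "k * a" "cf_num a n"] cf_den_num_err[of n] cf_err_pos[of n]
      by (simp add: k abs_mult)
    then have "real k * dist_int (k * a) \<le> real k * cf_err a n"
      by (intro mult_left_mono) auto
    then have "c \<le> cf_den a n * cf_err a n"
      using c(2)[OF k(2)] k(1) by simp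
    then have "cf_coeff a n * c \<le> cf_coeff a n * (cf_den a n * cf_err a n)"
      using cf_coeff_ge_1[of m] Suc by (intro mult_left_mono) auto
    also have "\<dots> \<le> cf_den a (Suc n) * cf_err a n"
    proof -
      have "cf_coeff a n * cf_den a n \<le> cf_den a (Suc n)"
        using cf_den_nonneg[of m] Suc by simp
      then have "real_of_int (cf_coeff a n * cf_den a n) * cf_err a n \<le> cf_den a (Suc n) * cf_err a n"
        using cf_err_pos[of n] by (intro mult_right_mono) (simp_all only: of_int_le_iff less_imp_le)
      then show ?thesis by simp
    qed
    also have "\<dots> \<le> 1"
      by (rule cf_den_err_le)
    finally have "real_of_int (cf_coeff a n) \<le> 1 / c" using c(1) by (simp add: field_simps)
    then show ?thesis by linarith
  qed simp
  then show ?thesis unfolding bounded_partial_quotients_def by blast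
qed

lemma bounded_partial_quotients_iff: "bounded_partial_quotients a \<longleftrightarrow> badly_approximable a"
  using bounded_imp_badly_approximable badly_approximable_imp_bounded by blast

end

section \<open>Orbits of the rotation\<close>

lemma dist_int_split:
  obtains e where "x = of_int (round x) + e" "\<bar>e\<bar> = dist_int x"
  by (rule that[of "x - of_int (round x)"]) (auto simp: dist_int_def)

lemma dist_int_add: "dist_int (x + y) \<le> dist_int x + dist_int y"
  using dist_int_le[of "x + y" "round x + round y"] by (simp add: dist_int_def)

lemma dist_int_minus: "dist_int (- x) = dist_int x"
proof -
  have "dist_int (- x) \<le> dist_int x" for x :: real
    using dist_int_le[of "- x" "- round x"] by (simp add: dist_int_def)
  from this[of x] this[of "- x"] show ?thesis by simp
qed

text \<open>This says that \<open>p / N\<close> is in lowest terms and within \<open>1 / N^2\<close>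
  of \<open>a\<close>. The name refers to the consequence that \<open>N\<close> consecutive orbit
  points fill every arc evenly up to a bounded error.\<close>

definition equidistributing :: "real \<Rightarrow> nat \<Rightarrow> bool" where
  "equidistributing a N \<longleftrightarrow> N \<ge> 1 \<and> (\<exists>p. coprime p (int N) \<and> \<bar>real N * a - of_int p\<bar> < 1 / real N)"

text \<open>Compare with the rational rotation by \<open>p / N\<close>: the integer \<open>z j\<close> below is the position of
  the \<open>j\<close>-th orbit point on the grid of mesh \<open>1 / N\<close>, up to an error of less than two cells.\<close>
lemma card_orbit_le:
  assumes "equidistributing a N" and uv: "u \<le> v"
  shows "real (card {j. j < N \<and> u \<le> frac (t + real j * a) \<and> frac (t + real j * a) < v})
    \<le> real N * (v - u) + 4"
proof -
  obtain p where N: "N \<ge> 1" and cop: "coprime p (int N)" and p: "\<bar>real N * a - of_int p\<bar> < 1 / real N"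
    using assms by (auto simp: equidistributing_def)
  define S where "S = {j. j < N \<and> u \<le> frac (t + real j * a) \<and> frac (t + real j * a) < v}"
  define m where "m = \<lfloor>real N * t\<rfloor>"
  define z where "z j = m + int j * p - int N * \<lfloor>t + real j * a\<rfloor>" for j :: nat
  \<comment> \<open>Since \<open>p\<close> is invertible modulo \<open>N\<close>, equal grid
    positions force equal indices.\<close>
  have "inj_on z S"
  proof (rule inj_onI)
    fix i j assume ij: "i \<in> S" "j \<in> S" "z i = z j"
    then have "(int i - int j) * p = int N * (\<lfloor>t + real i * a\<rfloor> - \<lfloor>t + real j * a\<rfloor>)"
      by (simp add: z_def algebra_simps)
    then have "int N dvd (int i - int j) * p" by simp
    then have "int N dvd int i - int j"
      using cop by (simp add: coprime_commute coprime_dvd_mult_left_iff)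
    moreover have "\<bar>int i - int j\<bar> < int N" using ij by (auto simp: S_def)
    ultimately show "i = j"
      by (smt (verit) dvd_imp_le_int of_nat_eq_iff)
  qed
  moreover have "z ` S \<subseteq> {\<lfloor>real N * u\<rfloor> - 1 .. \<lceil>real N * v\<rceil>}"
  proof
    fix y assume "y \<in> z ` S"
    then obtain j where j: "j \<in> S" and y: "y = z j" by blast
    have "\<bar>real j * (real N * a - of_int p)\<bar> < 1"
    proof -
      have "\<bar>real j * (real N * a - of_int p)\<bar> \<le> real N * \<bar>real N * a - of_int p\<bar>"
        using j by (auto simp: S_def abs_mult intro!: mult_right_mono)
      also have "\<dots> < 1" using p N by (simp add: field_simps)
      finally show ?thesis .
    qed
    \<comment> \<open>The offset lies between -1 and 2: the first summand is in
      \<open>[0,1)\<close>, and the accumulated drift is below 1 in absolute value. With rounding of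
      both endpoints this leads to the constant 4.\<close>
    moreover have "real N * frac (t + real j * a) - z j
        = (real N * t - m) + real j * (real N * a - of_int p)"
      by (simp add: z_def frac_def algebra_simps)
    moreover have "0 \<le> real N * t - m" "real N * t - m < 1" unfolding m_def by linarith+
    moreover have "real N * u \<le> real N * frac (t + real j * a)"
      using j by (auto simp: S_def intro!: mult_left_mono)
    moreover have "real N * frac (t + real j * a) < real N * v"
      using j N by (auto simp: S_def intro!: mult_strict_left_mono)
    ultimately have "real N * u - 2 < z j" "z j < real N * v + 1" by linarith+
    then show "y \<in> {\<lfloor>real N * u\<rfloor> - 1 .. \<lceil>real N * v\<rceil>}"
      unfolding y by simp linarith
  qed
  ultimately have "card S \<le> card {\<lfloor>real N * u\<rfloor> - 1 .. \<lceil>real N * v\<rceil>}"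
    by (metis card_image card_mono finite_atLeastAtMost_int)
  also have "real \<dots> \<le> real N * (v - u) + 4"
  proof -
    have "real N * u \<le> real N * v" using uv by (intro mult_left_mono) auto
    then show ?thesis by (simp add: algebra_simps) linarith
  qed
  finally show ?thesis unfolding S_def by simp
qed

text \<open>The two index sets partition the \<open>N\<close> indices, so the upper bound for one is
  a lower bound for the other.\<close>

lemma card_orbit_ge:
  assumes "equidistributing a N" and "0 \<le> u" "u \<le> 1"
  shows "real (card {j. j < N \<and> frac (t + real j * a) < u}) \<ge> real N * u - 4"
    and "real (card {j. j < N \<and> u \<le> frac (t + real j * a)}) \<ge> real N * (1 - u) - 4"
proof -
  let ?A = "{j. j < N \<and> frac (t + real j * a) < u}" and ?B = "{j. j < N \<and> u \<le> frac (t + real j * a)}"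
  have "card ?A + card ?B = card (?A \<union> ?B)"
    by (rule card_Un_disjoint[symmetric]) auto
  also have "?A \<union> ?B = {..<N}" by auto
  finally have *: "real (card ?A) + real (card ?B) = real N" by simp
  have "real (card ?B) \<le> real N * (1 - u) + 4"
    using card_orbit_le[OF assms(1), of u 1 t] assms by (simp add: frac_lt_1)
  with * show "real (card ?A) \<ge> real N * u - 4" by (simp add: algebra_simps)
  have "real (card ?A) \<le> real N * u + 4"
    using card_orbit_le[OF assms(1), of 0 u t] assms by simp
  with * show "real (card ?B) \<ge> real N * (1 - u) - 4" by (simp add: algebra_simps)
qed

text \<open>\<open>crosses a q s\<close>: the short arc from \<open>s\<close> to \<open>s + q a\<close> on the circle passes through \<open>0\<close>.\<close>
definition crosses :: "real \<Rightarrow> nat \<Rightarrow> real \<Rightarrow> bool" where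
  "crosses a q s \<longleftrightarrow> \<lfloor>s + real q * a\<rfloor> \<noteq> \<lfloor>s\<rfloor> + round (real q * a)"

text \<open>The sign of the signed remainder of \<open>q * a\<close> decides on which side of 0 the
  starting points of crossing arcs lie; in both cases they fill an arc of length
  \<open>dist_int (q * a)\<close>.\<close>

lemma crosses_cases:
  obtains "\<And>s. crosses a q s \<longleftrightarrow> 1 - dist_int (real q * a) \<le> frac s"
  | "\<And>s. crosses a q s \<longleftrightarrow> frac s < dist_int (real q * a)"
proof -
  define x where "x = real q * a"
  obtain e where e: "x = of_int (round x) + e" "\<bar>e\<bar> = dist_int x" by (rule dist_int_split)
  have "\<bar>e\<bar> \<le> 1 / 2" using of_int_round_abs_le[of x] e(2) by (simp add: dist_int_def abs_minus_commute)
  have *: "\<lfloor>s + x\<rfloor> = \<lfloor>s\<rfloor> + round x + \<lfloor>frac s + e\<rfloor>" for s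
  proof -
    have "s + x = (frac s + e) + of_int (\<lfloor>s\<rfloor> + round x)"
      by (subst e) (simp add: frac_def)
    then show ?thesis by (metis floor_add_int add.commute)
  qed
  show ?thesis
  proof (cases "e \<ge> 0")
    case True
    have "crosses a q s \<longleftrightarrow> 1 - dist_int x \<le> frac s" for s
    proof -
      have "\<lfloor>frac s + e\<rfloor> \<noteq> 0 \<longleftrightarrow> 1 - e \<le> frac s"
        using True by (auto simp: floor_eq_iff)
      then show ?thesis using * True e(2) by (auto simp: crosses_def x_def[symmetric])
    qed
    then show ?thesis using that x_def by blast
  next
    case False
    have "crosses a q s \<longleftrightarrow> frac s < dist_int x" for s
    proof -
      have "\<lfloor>frac s + e\<rfloor> \<noteq> 0 \<longleftrightarrow> frac s < - e"
        using False frac_lt_1[of s] by (auto simp: floor_eq_iff)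
      then show ?thesis using * False e(2) by (auto simp: crosses_def x_def[symmetric])
    qed
    then show ?thesis using that x_def by blast
  qed
qed

lemma dist_int_le_1: "dist_int x \<le> 1"
  using of_int_round_abs_le[of x] by (simp add: dist_int_def abs_minus_commute)

lemma card_crosses:
  assumes "equidistributing a N"
  shows "real (card {j. j < N \<and> crosses a q (t + real j * a)}) \<le> real N * dist_int (real q * a) + 4"
    and "real (card {j. j < N \<and> crosses a q (t + real j * a)}) \<ge> real N * dist_int (real q * a) - 4"
proof -
  define d where "d = dist_int (real q * a)"
  have d: "0 \<le> d" "d \<le> 1" by (auto simp: d_def dist_int_nonneg dist_int_le_1)
  have "real (card {j. j < N \<and> crosses a q (t + real j * a)}) \<le> real N * d + 4 \<and>
    real (card {j. j < N \<and> crosses a q (t + real j * a)}) \<ge> real N * d - 4"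
    using card_orbit_le[OF assms, of "1 - d" 1 t] card_orbit_ge[OF assms, of "1 - d" t]
      card_orbit_le[OF assms, of 0 d t] card_orbit_ge[OF assms, of d t] d
    by (cases rule: crosses_cases[of a q]) (simp_all add: d_def[symmetric] frac_lt_1)
  then show "real (card {j. j < N \<and> crosses a q (t + real j * a)}) \<le> real N * dist_int (real q * a) + 4"
    and "real (card {j. j < N \<and> crosses a q (t + real j * a)}) \<ge> real N * dist_int (real q * a) - 4"
    by (auto simp: d_def)
qed

lemma crosses_imp_dist_int_less:
  assumes "crosses a q s" "crosses a q s'"
  shows "\<bar>frac s - frac s'\<bar> < dist_int (real q * a)" 
proof (cases rule: crosses_cases[of a q])
  case 1
  then show ?thesis using assms frac_lt_1[of s] frac_lt_1[of s'] by auto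
next
  case 2
  then show ?thesis using assms frac_ge_0[of s] frac_ge_0[of s'] by (auto simp: abs_if simp del: frac_ge_0)
qed

text \<open>Two crossing points of one orbit lie in the same short arc, so their time difference
  approximates better than \<open>q\<close>. Crossings less than the next best denominator apart are
  therefore impossible.\<close>

lemma crosses_disjoint:
  assumes "crosses a q (t + real i * a)" "crosses a q (t + real j * a)" "i < j"
  shows "dist_int (real (j - i) * a) < dist_int (real q * a)"
proof -
  have "dist_int (real (j - i) * a) \<le> \<bar>frac (t + real j * a) - frac (t + real i * a)\<bar>"
    using dist_int_le[of "real (j - i) * a" "\<lfloor>t + real j * a\<rfloor> - \<lfloor>t + real i * a\<rfloor>"] assms(3)
    by (simp add: frac_def of_nat_diff algebra_simps)
  with crosses_imp_dist_int_less[OF assms(2,1)] show ?thesis by simp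
qed

section \<open>Itineraries and return times of the rotation\<close>

definition same_itinerary :: "real \<Rightarrow> nat \<Rightarrow> real \<Rightarrow> real \<Rightarrow> bool" where
  "same_itinerary a n t s \<longleftrightarrow> (\<forall>i\<le>n. \<lfloor>t + real i * a\<rfloor> = \<lfloor>s + real i * a\<rfloor>)"

text \<open>The condition \<open>T^k U \<inter> U \<noteq> {}\<close> for the atom \<open>U\<close>
  of \<open>t\<close>, written for the rotation; the same set of times will serve for the
  subshift.\<close>

definition return_times :: "real \<Rightarrow> nat \<Rightarrow> real \<Rightarrow> nat set" where
  "return_times a n t = {k. 1 \<le> k \<and> (\<exists>s\<in>{0..<1}. same_itinerary a n t s
     \<and> same_itinerary a n t (frac (s + real k * a)))}"

text \<open>No floor changes while \<open>t\<close> moves left by at most the least fractional part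
  on its orbit, or right by less than 1 minus the greatest. The resulting length is 1, or congruent
  modulo 1 to a difference of two orbit points.\<close>

lemma itinerary_interval:
  assumes "t \<in> {0..<1}"
  obtains u v where "u < v" "\<And>s. u \<le> s \<Longrightarrow> s < v \<Longrightarrow> s \<in> {0..<1} \<and> same_itinerary a n t s"
    "1 \<le> v - u \<or> (\<exists>k. 1 \<le> k \<and> k \<le> n \<and> dist_int (real k * a) \<le> v - u)"
proof -
  define F where "F = (\<lambda>i. frac (t + real i * a)) ` {..n}"
  have F: "finite F" "F \<noteq> {}" by (auto simp: F_def)
  obtain i where i: "i \<le> n" "Max F = frac (t + real i * a)"
    using Max_in[OF F] unfolding F_def by blast
  obtain j where j: "j \<le> n" "Min F = frac (t + real j * a)"
    using Min_in[OF F] unfolding F_def by blast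
  define u v where "u = t - Min F" and "v = t + 1 - Max F"
  have bounds: "Min F \<le> frac (t + real l * a)" "frac (t + real l * a) \<le> Max F" if "l \<le> n" for l
    using that F by (auto simp: F_def)
  have "u < v" using frac_lt_1[of "t + real i * a"] i j by (simp add: u_def v_def)
      (smt (verit) frac_ge_0)
  moreover have "s \<in> {0..<1} \<and> same_itinerary a n t s" if "u \<le> s" "s < v" for s
  proof -
    have "\<lfloor>t + real l * a\<rfloor> = \<lfloor>s + real l * a\<rfloor>" if "l \<le> n" for l
    proof -
      have "s + real l * a = of_int \<lfloor>t + real l * a\<rfloor> + (s - t + frac (t + real l * a))"
        by (simp add: frac_def)
      moreover have "0 \<le> s - t + frac (t + real l * a)" "s - t + frac (t + real l * a) < 1"
        using bounds[OF that] \<open>u \<le> s\<close> \<open>s < v\<close> by (auto simp: u_def v_def)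
      ultimately show ?thesis by linarith
    qed
    moreover from this[of 0] assms have "s \<in> {0..<1}"
      by (auto simp: floor_eq_iff) (smt (verit) floor_less_one zero_le_floor floor_eq_iff)+
    ultimately show ?thesis by (auto simp: same_itinerary_def)
  qed
  moreover have "1 \<le> v - u \<or> (\<exists>k. 1 \<le> k \<and> k \<le> n \<and> dist_int (real k * a) \<le> v - u)"
  proof (cases "i = j")
    case True
    then show ?thesis using i j by (simp add: u_def v_def)
  next
    case False
    have vu: "v - u = (real j - real i) * a - of_int (\<lfloor>t + real j * a\<rfloor> - \<lfloor>t + real i * a\<rfloor> - 1)"
      using i j by (simp add: u_def v_def frac_def algebra_simps)
    then have le: "dist_int ((real j - real i) * a) \<le> v - u"
      using dist_int_le[of "(real j - real i) * a" "\<lfloor>t + real j * a\<rfloor> - \<lfloor>t + real i * a\<rfloor> - 1"]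
        \<open>u < v\<close> by simp
    show ?thesis
    proof (cases "i < j")
      case True
      then have "dist_int (real (j - i) * a) \<le> v - u" using le by (simp add: of_nat_diff)
      then show ?thesis using True j by (intro disjI2 exI[of _ "j - i"]) auto
    next
      case False
      have "dist_int (real (i - j) * a) = dist_int (- ((real j - real i) * a))"
        using False by (simp add: of_nat_diff algebra_simps)
      then have "dist_int (real (i - j) * a) \<le> v - u" using le by (simp only: dist_int_minus)
      then show ?thesis using False \<open>i \<noteq> j\<close> i by (intro disjI2 exI[of _ "i - j"]) auto
    qed
  qed
  ultimately show ?thesis by (rule that)
qed

lemma return_times_intervalI:
  assumes "1 \<le> k" "\<And>s. u \<le> s \<Longrightarrow> s < v \<Longrightarrow> s \<in> {0..<1} \<and> same_itinerary a n t s"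
    and "dist_int (real k * a) < v - u"
  shows "k \<in> return_times a n t"
proof -
  obtain e where e: "real k * a = of_int (round (real k * a)) + e" "\<bar>e\<bar> = dist_int (real k * a)"
    by (rule dist_int_split)
  \<comment> \<open>For negative \<open>e\<close> the start moves right by
    \<open>\<bar>e\<bar>\<close>, so that \<open>s\<close> and \<open>s + e\<close> both lie in
    \<open>[u, v)\<close>.\<close>
  define s where "s = max u (u - e)"
  have s: "u \<le> s" "s < v" "u \<le> s + e" "s + e < v"
    using assms(3) e(2) by (auto simp: s_def)
  then have "frac (s + real k * a) = s + e"
    using assms(2)[of "s + e"] frac_add_of_int_right[of "s + e" "round (real k * a)"]
    by (subst e(1)) (simp add: frac_eq add_ac)
  then show ?thesis
    using assms(1) assms(2)[OF s(1,2)] assms(2)[OF s(3,4)] by (auto simp: return_times_def)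
qed

text \<open>Dirichlet's theorem in lowest terms. As \<open>k \<le> N\<close>, the error is also
  below \<open>1 / k\<close>, which makes \<open>k\<close> equidistributing.\<close>

lemma dirichlet_dist_int:
  assumes "N \<ge> 1"
  obtains k :: nat where "1 \<le> k" "k \<le> N" "dist_int (real k * a) < 1 / real N" "equidistributing a k"
proof -
  obtain h k where hk: "coprime h k" "0 < k" "k \<le> int N" "\<bar>of_int k * a - of_int h\<bar> < 1/N"
    using assms by (auto intro: Dirichlet_approx_coprime[of N a])
  have k: "real (nat k) = of_int k" "int (nat k) = k" using hk by auto
  have le: "1 / real N \<le> 1 / real (nat k)" using hk by (intro divide_left_mono) auto
  show ?thesis
  proof (rule that[of "nat k"])
    show "dist_int (real (nat k) * a) < 1 / real N"
      using dist_int_le[of "of_int k * a" h] hk unfolding k by linarith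
    show "equidistributing a (nat k)"
      unfolding equidistributing_def k using hk le k by (auto intro!: exI[of _ h])
  qed (use hk in auto)
qed

lemma return_times_nonempty:
  assumes "t \<in> {0..<1}"
  shows "return_times a n t \<noteq> {}"
proof -
  obtain u v where uv: "u < v" "\<And>s. u \<le> s \<Longrightarrow> s < v \<Longrightarrow> s \<in> {0..<1} \<and> same_itinerary a n t s"
    using itinerary_interval[OF assms] by metis
  obtain N :: nat where N: "N \<ge> 1" "1 / real N < v - u"
    using uv(1) by (metis One_nat_def Suc_leI diff_gt_0_iff_gt nat_approx_posE of_nat_Suc zero_less_Suc)
  obtain k where "1 \<le> k" "dist_int (real k * a) < 1 / real N"
    using dirichlet_dist_int[OF N(1)] by metis
  with N uv show ?thesis using return_times_intervalI[of k u v a n t] by force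
qed

text \<open>Bad approximability makes the atom at least \<open>c / n\<close> long, and Dirichlet
  with \<open>N\<close> about \<open>n / c\<close> finds a shift shorter than that.\<close>

lemma return_time_le:
  assumes "t \<in> {0..<1}" "n \<ge> 1" "c > 0"
    and c: "\<And>k. 1 \<le> k \<Longrightarrow> c \<le> real k * dist_int (real k * a)"
  obtains k where "k \<in> return_times a n t" "real k \<le> real n / c + 1"
proof -
  obtain u v where uv: "u < v" "\<And>s. u \<le> s \<Longrightarrow> s < v \<Longrightarrow> s \<in> {0..<1} \<and> same_itinerary a n t s"
    "1 \<le> v - u \<or> (\<exists>k. 1 \<le> k \<and> k \<le> n \<and> dist_int (real k * a) \<le> v - u)"
    using itinerary_interval[OF assms(1)] by metis
  have "c \<le> 1" using c[of 1] dist_int_le_1[of a] by simp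
  have vu: "c / real n \<le> v - u"
    using uv(3)
  proof
    assume "1 \<le> v - u"
    moreover have "c / real n \<le> 1" using \<open>c \<le> 1\<close> assms(2) by (simp add: field_simps)
    ultimately show ?thesis by simp
  next
    assume "\<exists>k. 1 \<le> k \<and> k \<le> n \<and> dist_int (real k * a) \<le> v - u"
    then obtain k where k: "1 \<le> k" "k \<le> n" "dist_int (real k * a) \<le> v - u" by blast
    have "c \<le> real k * dist_int (real k * a)" using c k by blast
    also have "\<dots> \<le> real n * (v - u)" using k dist_int_nonneg by (intro mult_mono) auto
    finally show ?thesis using assms(2) by (simp add: field_simps)
  qed
  define N where "N = nat \<lceil>real n / c\<rceil>"
  have "0 < real n / c" using assms by simp
  then have N: "N \<ge> 1" "real n / c \<le> real N" "real N \<le> real n / c + 1"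
    unfolding N_def by linarith+
  obtain k where k: "1 \<le> k" "k \<le> N" "dist_int (real k * a) < 1 / real N"
    using dirichlet_dist_int[OF N(1)] by metis
  have "1 / real N \<le> c / real n"
    using N \<open>c > 0\<close> assms(2) by (simp add: field_simps)
  then have "dist_int (real k * a) < v - u" using k vu by simp
  then have "k \<in> return_times a n t" using return_times_intervalI uv(2) k(1) by blast
  moreover have "real k \<le> real n / c + 1" using k N by linarith
  ultimately show ?thesis by (rule that)
qed

text \<open>If the points were further apart than \<open>4 / N\<close>, some orbit point of the
  right one would fall just after an integer, closer than their gap. The integer would then separate
  the two orbits at that time.\<close>

lemma same_itinerary_close:
  assumes "same_itinerary a n s s'" "equidistributing a N" "N \<le> n" "s \<in> {0..<1}" "s' \<in> {0..<1}"
  shows "\<bar>s - s'\<bar> \<le> 4 / real N"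
proof -
  have "s' - s \<le> 4 / real N" if same: "same_itinerary a n s s'" and s: "s \<in> {0..<1}" "s' \<in> {0..<1}" for s s'
  proof (rule ccontr)
    assume "\<not> s' - s \<le> 4 / real N"
    then have l: "4 / real N < s' - s" by simp
    have "N \<ge> 1" using assms(2) by (simp add: equidistributing_def)
    then have "0 < 4 / real N" by simp
    then have l': "0 \<le> s' - s" using l by linarith
    have l'': "s' - s \<le> 1" using s by simp
    have "0 < real N * (s' - s) - 4" using l \<open>N \<ge> 1\<close> by (simp add: field_simps)
    also have "\<dots> \<le> real (card {j. j < N \<and> frac (s' + real j * a) < s' - s})"
      using card_orbit_ge(1)[OF assms(2) l' l''] .
    finally have "{j. j < N \<and> frac (s' + real j * a) < s' - s} \<noteq> {}"
      by (metis card.empty of_nat_0 less_irrefl)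
    then obtain j where "j < N" and less: "frac (s' + real j * a) < s' - s" by blast
    then have "\<lfloor>s + real j * a\<rfloor> = \<lfloor>s' + real j * a\<rfloor>"
      using same assms(3) by (auto simp: same_itinerary_def)
    then show False using less by (simp add: frac_def) linarith
  qed
  from this[of s s'] this[of s' s] assms show ?thesis
    by (auto simp: same_itinerary_def abs_le_iff)
qed

lemma return_times_dist_int:
  assumes "k \<in> return_times a n t"
  obtains s s' where "s \<in> {0..<1}" "s' \<in> {0..<1}" "same_itinerary a n t s" "same_itinerary a n t s'"
    "dist_int (real k * a) \<le> \<bar>s - s'\<bar>"
proof -
  obtain s where s: "s \<in> {0..<1}" "same_itinerary a n t s" "same_itinerary a n t (frac (s + real k * a))"
    using assms by (auto simp: return_times_def)
  have "dist_int (real k * a) \<le> \<bar>s - frac (s + real k * a)\<bar>"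
    using dist_int_le[of "real k * a" "\<lfloor>s + real k * a\<rfloor>"] by (simp add: frac_def abs_minus_commute)
  then show ?thesis using s frac_lt_1 by (intro that[of s "frac (s + real k * a)"]) auto
qed

text \<open>A Dirichlet denominator \<open>N \<le> n\<close> satisfies \<open>N \<ge> c * n\<close>,
  so the atom has diameter at most \<open>4 / N\<close>. A return at \<open>k\<close> thus needs
  \<open>dist_int (k * a) \<le> 4 / N\<close>, while \<open>c\<close> bounds
  \<open>k * dist_int (k * a)\<close> below.\<close>

lemma return_time_ge:
  assumes "k \<in> return_times a n t" "n \<ge> 1" "c > 0"
    and c: "\<And>k. 1 \<le> k \<Longrightarrow> c \<le> real k * dist_int (real k * a)"
  shows "c\<^sup>2 * real n / 4 \<le> real k"
proof -
  obtain s s' where s: "s \<in> {0..<1}" "s' \<in> {0..<1}" "same_itinerary a n t s" "same_itinerary a n t s'"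
    "dist_int (real k * a) \<le> \<bar>s - s'\<bar>"
    using return_times_dist_int[OF assms(1)] .
  obtain N where N: "1 \<le> N" "N \<le> n" "dist_int (real N * a) < 1 / real n" "equidistributing a N"
    using dirichlet_dist_int[OF assms(2)] .
  have "c \<le> real N * dist_int (real N * a)" using c N by blast
  also have "\<dots> < real N * (1 / real n)" using N by (intro mult_strict_left_mono) auto
  finally have cN: "c * real n \<le> real N" using assms(2) by (simp add: field_simps)
  have "same_itinerary a n s s'" using s by (auto simp: same_itinerary_def)
  from same_itinerary_close[OF this N(4) N(2) s(1,2)] s(5)
  have d: "dist_int (real k * a) \<le> 4 / real N" by linarith
  have "1 \<le> k" using assms(1) by (simp add: return_times_def)
  then have "c \<le> real k * dist_int (real k * a)" by (rule c)
  also have "\<dots> \<le> real k * (4 / real N)" using d by (intro mult_left_mono) auto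
  finally have "c * real N \<le> 4 * real k" using N by (simp add: field_simps)
  moreover have "c * (c * real n) \<le> c * real N" using cN \<open>c > 0\<close> by (intro mult_left_mono) auto
  ultimately show ?thesis by (simp add: power2_eq_square)
qed

text \<open>The point \<open>t\<close> is itself the witness: without a crossing, moving by
  \<open>q * a\<close> modulo 1 changes none of the floors.\<close>

lemma not_crosses_return_time:
  assumes "t \<in> {0..<1}" "1 \<le> q" "\<And>i. i \<le> n \<Longrightarrow> \<not> crosses a q (t + real i * a)"
  shows "q \<in> return_times a n t"
proof -
  have "\<lfloor>t\<rfloor> = 0" using assms(1) by (auto simp: floor_eq_iff)
  then have "\<lfloor>t + real q * a\<rfloor> = round (real q * a)"
    using assms(3)[of 0] by (simp add: crosses_def)
  then have "frac (t + real q * a) = t + real q * a - of_int (round (real q * a))"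
    by (simp add: frac_def)
  moreover have "\<lfloor>t + real q * a - of_int (round (real q * a)) + real i * a\<rfloor> = \<lfloor>t + real i * a\<rfloor>" if "i \<le> n" for i
  proof -
    have "t + real q * a - of_int (round (real q * a)) + real i * a
      = (t + real i * a + real q * a) - of_int (round (real q * a))" by simp
    then show ?thesis using assms(3)[OF that] by (simp only: crosses_def floor_diff_of_int) simp
  qed
  ultimately have "same_itinerary a n t (frac (t + real q * a))"
    by (simp add: same_itinerary_def)
  moreover have "same_itinerary a n t t" by (simp add: same_itinerary_def)
  ultimately show ?thesis using assms(1,2) unfolding return_times_def by blast
qed

text \<open>As \<open>i\<close> and \<open>i + q\<close> are both at most \<open>n\<close>, the
  itinerary records the crossing. All points of the atom then cross at time \<open>i\<close>, which
  confines the atom to an arc of length \<open>dist_int (q * a)\<close>.\<close>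

lemma crosses_return_time:
  assumes "crosses a q (t + real i * a)" "i + q \<le> n" "k \<in> return_times a n t"
  shows "dist_int (real k * a) < dist_int (real q * a)"
proof -
  obtain s s' where s: "s \<in> {0..<1}" "s' \<in> {0..<1}" "same_itinerary a n t s" "same_itinerary a n t s'"
    "dist_int (real k * a) \<le> \<bar>s - s'\<bar>"
    using return_times_dist_int[OF assms(3)] .
  have *: "crosses a q (y + real i * a)" "\<lfloor>t + real i * a\<rfloor> = \<lfloor>y + real i * a\<rfloor>"
    if "same_itinerary a n t y" for y
  proof -
    have e: "\<lfloor>t + real i * a\<rfloor> = \<lfloor>y + real i * a\<rfloor>"
      using that assms(2) unfolding same_itinerary_def by (meson add_leD1)
    have "\<lfloor>t + real (i + q) * a\<rfloor> = \<lfloor>y + real (i + q) * a\<rfloor>"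
      using that assms(2) unfolding same_itinerary_def by blast
    then show "crosses a q (y + real i * a)"
      using assms(1) e by (simp add: crosses_def algebra_simps)
    show "\<lfloor>t + real i * a\<rfloor> = \<lfloor>y + real i * a\<rfloor>" by (rule e)
  qed
  have "\<bar>frac (s + real i * a) - frac (s' + real i * a)\<bar> < dist_int (real q * a)"
    using *(1)[OF s(3)] *(1)[OF s(4)] by (rule crosses_imp_dist_int_less)
  then show ?thesis using s(5) *(2)[OF s(3)] *(2)[OF s(4)] by (simp add: frac_def)
qed

section \<open>Best approximation denominators of an irrational number\<close>

context
  fixes a :: real
  assumes irr: "a \<notin> \<rat>"
begin

lemma dist_int_pos: 
  assumes "1 \<le> k"
  shows "0 < dist_int (real k * a)"
proof (rule ccontr)
  assume "\<not> ?thesis"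
  then have "real k * a = of_int (round (real k * a))"
    by (simp add: dist_int_def)
  then have "a = of_int (round (real k * a)) / real k" using assms by (simp add: field_simps)
  then show False using irr by (metis Rats_divide Rats_of_int Rats_of_nat)
qed

lemma best_approximation:
  assumes "1 \<le> M"
  obtains q where "1 \<le> q" "q \<le> M" "\<forall>j. 1 \<le> j \<longrightarrow> j \<le> M \<longrightarrow> dist_int (real q * a) \<le> dist_int (real j * a)"
proof -
  define F where "F = (\<lambda>j. dist_int (real j * a)) ` {1..M}"
  have F: "finite F" "F \<noteq> {}" using assms by (auto simp: F_def)
  obtain q where q: "q \<in> {1..M}" "Min F = dist_int (real q * a)"
    using Min_in[OF F] unfolding F_def by blast
  have "dist_int (real q * a) \<le> dist_int (real j * a)" if "1 \<le> j" "j \<le> M" for j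
    unfolding q(2)[symmetric] using F that by (intro Min_le) (auto simp: F_def)
  with q(1) show ?thesis by (intro that[of q]) auto
qed

text \<open>Asking Dirichlet for an error below every \<open>dist_int (j * a)\<close> with
  \<open>j \<le> Suc M\<close> forces a denominator above \<open>M\<close>. Such denominators let
  the bounded counting errors become negligible.\<close>

lemma dirichlet_large:
  obtains k where "M < k" "dist_int (real k * a) < 1 / real k" "equidistributing a k"
proof -
  obtain q where q: "1 \<le> q" "q \<le> Suc M" "\<forall>j. 1 \<le> j \<longrightarrow> j \<le> Suc M \<longrightarrow> dist_int (real q * a) \<le> dist_int (real j * a)"
    by (rule best_approximation[of "Suc M"]) auto
  obtain N :: nat where N: "N \<ge> 1" "1 / real N < dist_int (real q * a)"
    using dist_int_pos[OF q(1)] by (metis One_nat_def Suc_leI nat_approx_posE of_nat_Suc zero_less_Suc)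
  obtain k where k: "1 \<le> k" "k \<le> N" "dist_int (real k * a) < 1 / real N" "equidistributing a k"
    using dirichlet_dist_int[OF N(1)] .
  have "M < k"
  proof (rule ccontr)
    assume "\<not> M < k"
    then have "dist_int (real q * a) \<le> dist_int (real k * a)" using k(1) by (intro q(3)[rule_format]) auto
    then show False using N k by linarith
  qed
  moreover have "1 / real N \<le> 1 / real k" using k by (intro divide_left_mono) auto
  ultimately show ?thesis using k by (intro that[of k]) auto
qed

text \<open>Here \<open>q\<close> is optimal up to \<open>M\<close> and \<open>q'\<close> is the
  first strictly better denominator. The last two bounds pin \<open>dist_int (q * a)\<close> to the
  order of \<open>1 / q'\<close>: Dirichlet at \<open>q' - 1\<close> gives the upper one, a
  determinant the lower one.\<close>

lemma consecutive_best_approximations: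
  assumes "1 \<le> M"
  obtains q q' where "1 \<le> q" "q \<le> M" "M < q'"
    "\<forall>j. 1 \<le> j \<longrightarrow> j < q' \<longrightarrow> dist_int (real q * a) \<le> dist_int (real j * a)"
    "dist_int (real q' * a) < dist_int (real q * a)"
    "real (q' - 1) * dist_int (real q * a) < 1"
    "1 \<le> 2 * real q' * dist_int (real q * a)"
proof -
  obtain q where q: "1 \<le> q" "q \<le> M"
    "\<forall>j. 1 \<le> j \<longrightarrow> j \<le> M \<longrightarrow> dist_int (real q * a) \<le> dist_int (real j * a)"
    using best_approximation[OF assms] .
  define P where "P k \<longleftrightarrow> 1 \<le> k \<and> dist_int (real k * a) < dist_int (real q * a)" for k
  obtain N :: nat where N: "N \<ge> 1" "1 / real N < dist_int (real q * a)"
    using dist_int_pos[OF q(1)] by (metis One_nat_def Suc_leI nat_approx_posE of_nat_Suc zero_less_Suc)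
  obtain k where "1 \<le> k" "dist_int (real k * a) < 1 / real N"
    using dirichlet_dist_int[OF N(1)] by metis
  then have "P k" using N by (simp add: P_def)
  define q' where "q' = (LEAST k. P k)"
  have q': "1 \<le> q'" "dist_int (real q' * a) < dist_int (real q * a)"
    using LeastI[of P, OF \<open>P k\<close>] by (auto simp: q'_def P_def)
  have least: "dist_int (real q * a) \<le> dist_int (real j * a)" if "1 \<le> j" "j < q'" for j
    using not_less_Least[of j P] that by (auto simp: q'_def P_def)
  have "M < q'" using q(3)[rule_format, of q'] q' by linarith
  have "real (q' - 1) * dist_int (real q * a) < 1"
  proof -
    have "1 \<le> q' - 1" using \<open>M < q'\<close> assms by simp
    then obtain k where k: "1 \<le> k" "k \<le> q' - 1" "dist_int (real k * a) < 1 / real (q' - 1)"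
      using dirichlet_dist_int by metis
    have "dist_int (real q * a) \<le> dist_int (real k * a)" using k q' by (intro least) auto
    then have "dist_int (real q * a) < 1 / real (q' - 1)" using k by simp
    then show ?thesis using \<open>1 \<le> q' - 1\<close> by (simp add: field_simps)
  qed
  moreover have "1 \<le> 2 * real q' * dist_int (real q * a)"
  proof -
    define d d' where "d = dist_int (real q * a)" and "d' = dist_int (real q' * a)"
    define p p' where "p = round (real q * a)" and "p' = round (real q' * a)"
    have d: "d = \<bar>real q * a - p\<bar>" "d' = \<bar>real q' * a - p'\<bar>"
      by (auto simp: d_def d'_def p_def p'_def dist_int_def)
    have qq: "real q < real q'" "d' < d" "0 \<le> d'"
      using \<open>M < q'\<close> q q' by (auto simp: d_def d'_def dist_int_nonneg)
    have less: "real q * d' < real q' * d"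
      using qq q(1) by (intro mult_strict_mono) auto
    \<comment> \<open>The determinant of the two approximations is nonzero because
      \<open>q * d' < q' * d\<close>; hence
      \<open>1 \<le> \<bar>D\<bar> \<le> q' * d + q * d'\<close>, which is less than
      \<open>2 * q' * d\<close>.\<close>
    define D where "D = int q * p' - int q' * p"
    have D: "real_of_int D = real q' * (real q * a - p) - real q * (real q' * a - p')"
      by (simp add: D_def algebra_simps)
    have "D \<noteq> 0"
    proof
      assume "D = 0"
      then have "\<bar>real q' * (real q * a - p)\<bar> = \<bar>real q * (real q' * a - p')\<bar>" using D by simp
      then show False using less by (simp add: abs_mult d)
    qed
    then have "1 \<le> \<bar>real_of_int D\<bar>" by linarith
    also have "\<dots> \<le> real q' * d + real q * d'"
      unfolding D d by (rule order_trans[OF abs_triangle_ineq4]) (simp add: abs_mult)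
    finally show ?thesis using less unfolding d_def[symmetric] by linarith
  qed
  ultimately show ?thesis using q(1,2) q'(2) least \<open>M < q'\<close> by (intro that[of q q']) auto
qed

end

section \<open>Sturmian codings\<close>

lemma sturm_ind_floor:
  assumes "0 < a" "a < 1"
  shows "int (sturm_ind a (frac s)) = \<lfloor>s + a\<rfloor> - \<lfloor>s\<rfloor>"
proof -
  have "frac a = a" "\<lfloor>a\<rfloor> = 0" using assms by (auto simp: frac_eq floor_eq_iff)
  then show ?thesis by (simp add: sturm_ind_def floor_add)
qed

text \<open>Letter \<open>i\<close> is the increment from floor \<open>i\<close> to floor
  \<open>i + 1\<close>. Starting from floor 0 at time 0, the \<open>n\<close> letters are thus
  equivalent to the \<open>n + 1\<close> floors in \<open>same_itinerary\<close>.\<close>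

lemma same_code_iff:
  assumes "0 < a" "a < 1" "t \<in> {0..<1}" "s \<in> {0..<1}"
  shows "(\<forall>i<n. sturm_ind a (frac (t + real i * a)) = sturm_ind a (frac (s + real i * a)))
    \<longleftrightarrow> same_itinerary a n t s"
proof -
  have fl: "int (sturm_ind a (frac (y + real i * a))) = \<lfloor>y + real (Suc i) * a\<rfloor> - \<lfloor>y + real i * a\<rfloor>" for y i
    using sturm_ind_floor[OF assms(1,2), of "y + real i * a"] by (simp add: algebra_simps)
  have z: "\<lfloor>t\<rfloor> = 0" "\<lfloor>s\<rfloor> = 0" using assms by (auto simp: floor_eq_iff)
  show ?thesis
  proof
    assume L: "\<forall>i<n. sturm_ind a (frac (t + real i * a)) = sturm_ind a (frac (s + real i * a))"
    have "i \<le> n \<Longrightarrow> \<lfloor>t + real i * a\<rfloor> = \<lfloor>s + real i * a\<rfloor>" for i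
    proof (induction i)
      case (Suc i)
      then have "\<lfloor>t + real i * a\<rfloor> = \<lfloor>s + real i * a\<rfloor>" by simp
      moreover have "sturm_ind a (frac (t + real i * a)) = sturm_ind a (frac (s + real i * a))"
        using L Suc by simp
      ultimately show ?case using fl[of t i] fl[of s i] by linarith
    qed (simp add: z)
    then show "same_itinerary a n t s" by (simp add: same_itinerary_def)
  next
    assume R: "same_itinerary a n t s"
    show "\<forall>i<n. sturm_ind a (frac (t + real i * a)) = sturm_ind a (frac (s + real i * a))"
    proof (intro allI impI)
      fix i assume "i < n"
      then have "\<lfloor>t + real i * a\<rfloor> = \<lfloor>s + real i * a\<rfloor>"
        "\<lfloor>t + real (Suc i) * a\<rfloor> = \<lfloor>s + real (Suc i) * a\<rfloor>"
        using R unfolding same_itinerary_def by (meson less_imp_le Suc_leI)+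
      then show "sturm_ind a (frac (t + real i * a)) = sturm_ind a (frac (s + real i * a))"
        using fl[of t i] fl[of s i] by linarith
    qed
  qed
qed

text \<open>A common frame for the subshift and for the rotation itself: a system whose points carry
  a one-sided itinerary such that exactly the finite words of the rotation coding occur.\<close>

locale sturmian_coding =
  fixes \<alpha> :: real and T :: "'a \<Rightarrow> 'a" and X :: "'a set" and \<zeta> :: "'a set set"
    and cd :: "'a \<Rightarrow> nat \<Rightarrow> nat"
  assumes \<alpha>: "0 < \<alpha>" "\<alpha> < 1" "\<alpha> \<notin> \<rat>"
    and T_in: "x \<in> X \<Longrightarrow> T x \<in> X"
    and cd_T: "x \<in> X \<Longrightarrow> cd (T x) i = cd x (Suc i)"
    and part: "x \<in> X \<Longrightarrow> y \<in> X \<Longrightarrow> (\<forall>A\<in>\<zeta>. y \<in> A \<longleftrightarrow> x \<in> A) \<longleftrightarrow> cd y 0 = cd x 0"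
    and cd_lang: "x \<in> X \<Longrightarrow> \<exists>t\<in>{0..<1}. \<forall>i<n. cd x i = sturm_ind \<alpha> (frac (t + real i * \<alpha>))"
    and lang_cd: "t \<in> {0..<1} \<Longrightarrow> \<exists>x\<in>X. \<forall>i. cd x i = sturm_ind \<alpha> (frac (t + real i * \<alpha>))"
begin

text \<open>The point \<open>t\<close> may vary with \<open>n\<close>: a limit of codings need not
  be the coding of any single point, so only prefixes are matched.\<close>

definition codes :: "nat \<Rightarrow> real \<Rightarrow> 'a \<Rightarrow> bool" where
  "codes n t x \<longleftrightarrow> t \<in> {0..<1} \<and> (\<forall>i<n. cd x i = sturm_ind \<alpha> (frac (t + real i * \<alpha>)))"

definition \<tau> :: "nat \<Rightarrow> 'a \<Rightarrow> nat" where
  "\<tau> n x = first_return T (part_atom T X \<zeta> n x)"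

lemma obtain_codes:
  assumes "x \<in> X"
  obtains t where "codes n t x"
  using cd_lang[OF assms, of n] unfolding codes_def by blast

lemma funpow_in: "x \<in> X \<Longrightarrow> (T ^^ k) x \<in> X"
  by (induction k) (auto simp: T_in)

lemma cd_funpow: "x \<in> X \<Longrightarrow> cd ((T ^^ k) x) i = cd x (i + k)"
  by (induction k arbitrary: i) (auto simp: cd_T funpow_in)

lemma part_atom_eq:
  assumes "x \<in> X"
  shows "part_atom T X \<zeta> n x = {y \<in> X. \<forall>i<n. cd y i = cd x i}"
  unfolding part_atom_def using part[OF funpow_in[OF assms] funpow_in] cd_funpow assms
  by (auto simp: cd_funpow)

lemma codes_funpow:
  assumes "x \<in> X" "codes (n + k) t x"
  shows "codes n (frac (t + real k * \<alpha>)) ((T ^^ k) x)"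
proof -
  have "frac (frac (t + real k * \<alpha>) + real i * \<alpha>) = frac (t + real (i + k) * \<alpha>)" for i
    by (simp add: algebra_simps)
  then show ?thesis using assms by (auto simp: codes_def cd_funpow frac_lt_1 add.commute)
qed

lemma codes_iff_same_itinerary:
  assumes "codes n t x" "s \<in> {0..<1}"
  shows "(\<forall>i<n. cd x i = sturm_ind \<alpha> (frac (s + real i * \<alpha>))) \<longleftrightarrow> same_itinerary \<alpha> n t s"
  using same_code_iff[OF \<alpha>(1,2) _ assms(2), of t n] assms(1) by (auto simp: codes_def)

text \<open>A point of \<open>U\<close> returning at \<open>k\<close> has a prefix of length
  \<open>n + k\<close> coded by some \<open>s\<close>, which contains both copies of the word.
  Conversely, the full coding of \<open>s\<close> is realised by a point of
  \<open>X\<close>.\<close>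

lemma return_set_eq:
  assumes "x \<in> X" "codes n t x"
  defines "U \<equiv> part_atom T X \<zeta> n x"
  shows "{k. 1 \<le> k \<and> (T ^^ k) ` U \<inter> U \<noteq> {}} = return_times \<alpha> n t"
proof -
  have shift: "frac (frac (s + real k * \<alpha>) + real i * \<alpha>) = frac (s + real (i + k) * \<alpha>)" for s k i
    by (simp add: algebra_simps)
  have fr: "frac y \<in> {0..<1}" for y :: real by (simp add: frac_lt_1)
  have "(T ^^ k) ` U \<inter> U \<noteq> {} \<longleftrightarrow>
    (\<exists>s\<in>{0..<1}. same_itinerary \<alpha> n t s \<and> same_itinerary \<alpha> n t (frac (s + real k * \<alpha>)))" for k
  proof
    assume "(T ^^ k) ` U \<inter> U \<noteq> {}"
    then obtain y where y: "y \<in> U" "(T ^^ k) y \<in> U" by blast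
    then have yX: "y \<in> X" by (auto simp: U_def part_atom_def)
    then obtain s where s: "codes (n + k) s y" by (rule obtain_codes)
    have eq: "cd x i = cd y i" "cd x i = cd y (i + k)" if "i < n" for i
      using y that by (auto simp: U_def part_atom_eq[OF assms(1)] cd_funpow[OF yX])
    have "same_itinerary \<alpha> n t s"
      using s eq(1) codes_iff_same_itinerary[OF assms(2), of s] by (auto simp: codes_def)
    moreover have "same_itinerary \<alpha> n t (frac (s + real k * \<alpha>))"
      using s eq(2) codes_iff_same_itinerary[OF assms(2) fr, of "s + real k * \<alpha>"]
      by (auto simp: codes_def shift simp del: frac_add_simps)
    ultimately show "\<exists>s\<in>{0..<1}. same_itinerary \<alpha> n t s \<and> same_itinerary \<alpha> n t (frac (s + real k * \<alpha>))"
      using s by (auto simp: codes_def)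
  next
    assume "\<exists>s\<in>{0..<1}. same_itinerary \<alpha> n t s \<and> same_itinerary \<alpha> n t (frac (s + real k * \<alpha>))"
    then obtain s where s: "s \<in> {0..<1}" "same_itinerary \<alpha> n t s"
      "same_itinerary \<alpha> n t (frac (s + real k * \<alpha>))" by blast
    obtain y where y: "y \<in> X" "\<And>i. cd y i = sturm_ind \<alpha> (frac (s + real i * \<alpha>))"
      using lang_cd[OF s(1)] by blast
    have "y \<in> U"
      using codes_iff_same_itinerary[OF assms(2) s(1)] s(2) y
      by (auto simp: U_def part_atom_eq[OF assms(1)])
    moreover have "(T ^^ k) y \<in> U"
      using codes_iff_same_itinerary[OF assms(2) fr, of "s + real k * \<alpha>"] s(3) y
      by (auto simp: U_def part_atom_eq[OF assms(1)] cd_funpow funpow_in shift simp del: frac_add_simps)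
    ultimately show "(T ^^ k) ` U \<inter> U \<noteq> {}" by blast
  qed
  then show ?thesis by (simp add: return_times_def)
qed

lemma \<tau>_eq:
  assumes "x \<in> X" "codes n t x"
  shows "\<tau> n x = Inf (return_times \<alpha> n t)"
  using return_set_eq[OF assms] by (simp add: \<tau>_def first_return_def)

text \<open>The set of return times is nonempty, so its \<open>Inf\<close> is attained rather than a
  default value.\<close>

lemma \<tau>_in_return_times:
  assumes "x \<in> X" "codes n t x"
  shows "\<tau> n x \<in> return_times \<alpha> n t"
proof -
  have "t \<in> {0..<1}" using assms(2) by (simp add: codes_def)
  then show ?thesis unfolding \<tau>_eq[OF assms] by (intro Inf_nat_def1 return_times_nonempty)
qed

lemma \<tau>_le:
  assumes "x \<in> X" "codes n t x" "k \<in> return_times \<alpha> n t"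
  shows "\<tau> n x \<le> k"
  using assms by (simp add: \<tau>_eq cInf_lower)

lemma \<tau>_cong:
  assumes "x \<in> X" "y \<in> X" "\<And>i. i < n \<Longrightarrow> cd x i = cd y i"
  shows "\<tau> n x = \<tau> n y"
  unfolding \<tau>_def part_atom_eq[OF assms(1)] part_atom_eq[OF assms(2)]
  using assms(3) by (intro arg_cong[where f = "first_return T"]) auto

text \<open>The map \<open>T\<close> sends the \<open>Suc n\<close>-atom of \<open>x\<close> into
  the \<open>n\<close>-atom of \<open>T x\<close>, so returns of the former are returns of the
  latter. This makes the rates monotone along orbits.\<close>

lemma \<tau>_T_le:
  assumes "x \<in> X"
  shows "\<tau> n (T x) \<le> \<tau> (Suc n) x"
proof -
  obtain t where t: "codes (n + 1) t x" using obtain_codes[OF assms] .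
  define U where "U = part_atom T X \<zeta> (Suc n) x"
  define V where "V = part_atom T X \<zeta> n (T x)"
  have "\<tau> (Suc n) x \<in> {k. 1 \<le> k \<and> (T ^^ k) ` U \<inter> U \<noteq> {}}"
    using \<tau>_in_return_times[OF assms t] return_set_eq[OF assms t] by (simp add: U_def)
  then obtain y where k: "1 \<le> \<tau> (Suc n) x" and y: "y \<in> U" "(T ^^ \<tau> (Suc n) x) y \<in> U" by blast
  have UV: "T z \<in> V" if "z \<in> U" for z
    using that assms by (auto simp: U_def V_def part_atom_eq T_in cd_T)
  have "(T ^^ \<tau> (Suc n) x) (T y) \<in> V"
    using UV[OF y(2)] by (simp add: funpow_swap1)
  with UV[OF y(1)] k have "\<tau> (Suc n) x \<in> {k. 1 \<le> k \<and> (T ^^ k) ` V \<inter> V \<noteq> {}}" by blast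
  then show ?thesis unfolding \<tau>_def[of n] first_return_def V_def[symmetric] by (intro cInf_lower) auto
qed

lemma \<tau>_bounds:
  assumes "x \<in> X" "n \<ge> 1" "c > 0"
    and c: "\<And>k. 1 \<le> k \<Longrightarrow> c \<le> real k * dist_int (real k * \<alpha>)"
  shows "c\<^sup>2 / 4 \<le> real (\<tau> n x) / real n" "real (\<tau> n x) / real n \<le> 1 / c + 1"
proof -
  obtain t where t: "codes n t x" using obtain_codes[OF assms(1)] .
  then have "t \<in> {0..<1}" by (simp add: codes_def)
  then obtain k where k: "k \<in> return_times \<alpha> n t" "real k \<le> real n / c + 1"
    using return_time_le[OF _ assms(2,3) c] by metis
  have "real (\<tau> n x) \<le> real n / c + 1" using \<tau>_le[OF assms(1) t k(1)] k(2) by linarith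
  also have "\<dots> \<le> real n * (1 / c + 1)" using assms(2) by (simp add: algebra_simps)
  finally show "real (\<tau> n x) / real n \<le> 1 / c + 1" using assms(2) by (simp add: field_simps)
  have "c\<^sup>2 * real n / 4 \<le> real (\<tau> n x)"
    using return_time_ge[OF \<tau>_in_return_times[OF assms(1) t] assms(2,3) c] by blast
  then show "c\<^sup>2 / 4 \<le> real (\<tau> n x) / real n" using assms(2) by (simp add: field_simps)
qed

abbreviation "lower_rate \<equiv> lower_rec_rate T X \<zeta>"
abbreviation "upper_rate \<equiv> upper_rec_rate T X \<zeta>"

lemma lower_rate_eq: "lower_rate x = liminf (\<lambda>n. ereal (real (\<tau> n x) / real n))"
  by (simp add: lower_rec_rate_def \<tau>_def)

lemma upper_rate_eq: "upper_rate x = limsup (\<lambda>n. ereal (real (\<tau> n x) / real n))"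
  by (simp add: upper_rec_rate_def \<tau>_def)

lemma rates_badly_approximable:
  assumes "badly_approximable \<alpha>" "x \<in> X"
  shows "0 < lower_rate x" "upper_rate x < \<infinity>"
proof -
  obtain c where c: "c > 0" "\<And>k. 1 \<le> k \<Longrightarrow> c \<le> real k * dist_int (real k * \<alpha>)"
    using assms(1) unfolding badly_approximable_def by metis
  have "0 < ereal (c\<^sup>2 / 4)" using c(1) by simp
  also have "\<dots> \<le> lower_rate x"
    unfolding lower_rate_eq
    using \<tau>_bounds(1)[OF assms(2) _ c]
    by (intro Liminf_bounded eventually_sequentiallyI[of 1]) auto
  finally show "0 < lower_rate x" .
  have "upper_rate x \<le> ereal (1 / c + 1)"
    unfolding upper_rate_eq
    using \<tau>_bounds(2)[OF assms(2) _ c]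
    by (intro Limsup_bounded eventually_sequentiallyI[of 1]) auto
  then show "upper_rate x < \<infinity>" by (rule order_le_less_trans) simp
qed

text \<open>In terms of thresholds, the lower rate at \<open>T x\<close> is at most that at
  \<open>x\<close>, since \<open>\<tau> n (T x) \<le> \<tau> (Suc n) x\<close>.\<close>

lemma lower_rate_T:
  assumes "x \<in> X" "ereal r < lower_rate (T x)"
  shows "ereal r < lower_rate x"
proof -
  obtain r1 where r1: "ereal r < ereal r1" "ereal r1 < lower_rate (T x)"
    using ereal_dense2[OF assms(2)] by blast
  \<comment> \<open>The slack between \<open>r2\<close> and \<open>r1\<close> absorbs the index
    shift: \<open>r2 * (n + 1) \<le> r1 * n\<close> once
    \<open>n \<ge> r2 / (r1 - r2)\<close>.\<close>
  define r2 where "r2 = (r + r1) / 2"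
  have r2: "r < r2" "r2 < r1" using r1 by (auto simp: r2_def)
  have "eventually (\<lambda>n. ereal r1 < ereal (real (\<tau> n (T x)) / real n)) sequentially"
    using r1(2) unfolding lower_rate_eq by (rule less_LiminfD)
  moreover have "eventually (\<lambda>n::nat. r2 / (r1 - r2) \<le> real n) sequentially"
    by (rule eventually_ge_at_top[THEN filterlim_real_sequentially[unfolded filterlim_iff, rule_format]])
  moreover have "eventually (\<lambda>n::nat. 1 \<le> n) sequentially" by (rule eventually_ge_at_top)
  ultimately have "eventually (\<lambda>n. ereal r2 \<le> ereal (real (\<tau> (Suc n) x) / real (Suc n))) sequentially"
  proof eventually_elim
    case (elim n)
    have "r1 * real n \<le> real (\<tau> n (T x))" using elim by (simp add: field_simps)
    also have "\<dots> \<le> real (\<tau> (Suc n) x)" using \<tau>_T_le[OF assms(1)] by simp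
    finally have "r1 * real n \<le> real (\<tau> (Suc n) x)" .
    moreover have "r2 \<le> real n * (r1 - r2)" using elim(2) r2 by (simp add: field_simps)
    ultimately have "r2 * real (Suc n) \<le> real (\<tau> (Suc n) x)" by (simp add: algebra_simps)
    then show ?case by (simp add: field_simps)
  qed
  then have "eventually (\<lambda>n. ereal r2 \<le> ereal (real (\<tau> n x) / real n)) sequentially"
    by (rule eventually_sequentially_Suc[THEN iffD1])
  then have "ereal r2 \<le> lower_rate x"
    unfolding lower_rate_eq by (rule Liminf_bounded)
  moreover have "ereal r < ereal r2" using r2 by simp
  ultimately show ?thesis by (rule less_le_trans[rotated])
qed

lemma upper_rate_T:
  assumes "x \<in> X" "upper_rate x < ereal r"
  shows "upper_rate (T x) < ereal r"
proof -
  obtain r1 where r1: "upper_rate x < ereal r1" "ereal r1 < ereal r"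
    using ereal_dense2[OF assms(2)] by blast
  define r2 where "r2 = (r + r1) / 2"
  have r2: "r1 < r2" "r2 < r" using r1 by (auto simp: r2_def)
  have "eventually (\<lambda>n. ereal (real (\<tau> n x) / real n) < ereal r1) sequentially"
    using r1(1) unfolding upper_rate_eq by (rule Limsup_lessD)
  then have "eventually (\<lambda>n. ereal (real (\<tau> (Suc n) x) / real (Suc n)) < ereal r1) sequentially"
    by (rule eventually_sequentially_Suc[THEN iffD2])
  moreover have "eventually (\<lambda>n::nat. r1 / (r2 - r1) \<le> real n) sequentially"
    by (rule eventually_ge_at_top[THEN filterlim_real_sequentially[unfolded filterlim_iff, rule_format]])
  moreover have "eventually (\<lambda>n::nat. 1 \<le> n) sequentially" by (rule eventually_ge_at_top)
  ultimately have "eventually (\<lambda>n. ereal (real (\<tau> n (T x)) / real n) \<le> ereal r2) sequentially"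
  proof eventually_elim
    case (elim n)
    have "real (\<tau> n (T x)) \<le> real (\<tau> (Suc n) x)" using \<tau>_T_le[OF assms(1)] by simp
    also have "\<dots> \<le> r1 * real (Suc n)" using elim by (simp add: field_simps)
    finally have "real (\<tau> n (T x)) \<le> r1 * real n + r1" by (simp add: algebra_simps)
    moreover have "r1 \<le> real n * (r2 - r1)" using elim(2) r2 by (simp add: field_simps)
    ultimately have "real (\<tau> n (T x)) \<le> r2 * real n" by (simp add: algebra_simps)
    then show ?case using elim(3) by (simp add: field_simps)
  qed
  then have "upper_rate (T x) \<le> ereal r2"
    unfolding upper_rate_eq by (rule Limsup_bounded)
  moreover have "ereal r2 < ereal r" using r2 by simp
  ultimately show ?thesis by (rule le_less_trans)
qed

end

section \<open>Invariant measures\<close>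

text \<open>If almost every point were eventually outside, the indicators would tend to 0 and
  dominated convergence would send the measures to 0 as well, against the bound \<open>c\<close>
  along a subsequence.\<close>

lemma (in prob_space) not_eventually_avoids:
  assumes sets: "\<And>n. {x \<in> space M. R n x} \<in> sets M" and "c > 0"
    and often: "\<And>m. \<exists>n>m. c \<le> measure M {x \<in> space M. R n x}"
  shows "\<not> (AE x in M. eventually (\<lambda>n. \<not> R n x) sequentially)"
proof
  assume ae: "AE x in M. eventually (\<lambda>n. \<not> R n x) sequentially"
  obtain g where g: "\<And>m. g m > m" "\<And>m. c \<le> measure M {x \<in> space M. R (g m) x}"
    using often by metis
  have glim: "filterlim g at_top sequentially"
    by (rule filterlim_at_top_mono[OF filterlim_ident always_eventually]) (simp add: g(1) less_imp_le)
  have "(\<lambda>m. \<integral>x. indicator {x \<in> space M. R (g m) x} x \<partial>M) \<longlonglongrightarrow> (\<integral>x. (0::real) \<partial>M)"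
  proof (rule integral_dominated_convergence[where w = "\<lambda>_. 1"])
    show "AE x in M. (\<lambda>m. indicator {x \<in> space M. R (g m) x} x :: real) \<longlonglongrightarrow> 0"
      using ae
    proof eventually_elim
      case (elim x)
      then have "eventually (\<lambda>m. \<not> R (g m) x) sequentially"
        using glim by (auto simp: filterlim_iff)
      then have "eventually (\<lambda>m. indicator {x \<in> space M. R (g m) x} x = (0::real)) sequentially"
        by eventually_elim auto
      then show ?case by (rule tendsto_eventually)
    qed
    show "indicator {x \<in> space M. R (g m) x} \<in> borel_measurable M" for m
      using sets by (rule borel_measurable_indicator)
    show "AE x in M. norm (indicator {x \<in> space M. R (g m) x} x :: real) \<le> 1" for m
      by (rule AE_I2) (simp add: indicator_def)
  qed simp_all
  then have "(\<lambda>m. measure M {x \<in> space M. R (g m) x}) \<longlonglongrightarrow> 0"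
    using sets by (simp add: Int_absorb2 sets.sets_into_space)
  then have "c \<le> 0" by (rule LIMSEQ_le_const) (use g(2) in blast)
  then show False using \<open>c > 0\<close> by simp
qed

section \<open>Visit frequencies and conditioning for invariant probabilities\<close>

context sturmian_coding
begin

text \<open>Measurability is asked of one-letter cylinders, in a form shared by the Borel sets of
  the subshift and of the interval; it makes every \<open>\<tau> n\<close> measurable.\<close>

definition invariant_prob :: "'a measure \<Rightarrow> bool" where
  "invariant_prob M \<longleftrightarrow> prob_space M \<and> space M = X \<and> T \<in> measurable M M \<and> distr M M T = M
     \<and> (\<forall>i v. {x \<in> X. cd x i = v} \<in> sets M)"

lemma cylinder_measurable:
  assumes "invariant_prob M"
    and P: "\<And>x y. x \<in> X \<Longrightarrow> y \<in> X \<Longrightarrow> (\<And>i. i < n \<Longrightarrow> cd x i = cd y i) \<Longrightarrow> P x = P y"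
  shows "{x \<in> X. P x} \<in> sets M"
proof -
  have sp: "space M = X" and cdm: "\<And>i v. {x \<in> X. cd x i = v} \<in> sets M"
    using assms(1) by (auto simp: invariant_prob_def)
  define W where "W = {u. length u = n \<and> (\<exists>x\<in>X. P x \<and> (\<forall>i<n. cd x i = u ! i))}"
  have "{x \<in> X. P x} = (\<Union>u\<in>W. {x \<in> X. \<forall>i<n. cd x i = u ! i})"
  proof (intro equalityI subsetI)
    fix x assume x: "x \<in> {x \<in> X. P x}"
    then have "map (cd x) [0..<n] \<in> W" by (auto simp: W_def intro!: bexI[of _ x])
    moreover have "x \<in> {x' \<in> X. \<forall>i<n. cd x' i = map (cd x) [0..<n] ! i}" using x by auto
    ultimately show "x \<in> (\<Union>u\<in>W. {x \<in> X. \<forall>i<n. cd x i = u ! i})" by blast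
  next
    fix x assume "x \<in> (\<Union>u\<in>W. {x \<in> X. \<forall>i<n. cd x i = u ! i})"
    then obtain u y where "x \<in> X" "\<forall>i<n. cd x i = u ! i" "y \<in> X" "P y" "\<forall>i<n. cd y i = u ! i"
      by (auto simp: W_def)
    then show "x \<in> {x \<in> X. P x}" using P[of x y] by auto
  qed
  moreover have "{x \<in> X. \<forall>i<n. cd x i = u ! i} \<in> sets M" for u
  proof -
    have "{x \<in> X. \<forall>i<n. cd x i = u ! i} = {x \<in> space M. \<forall>i\<in>{..<n}. cd x i = u ! i}"
      using sp by auto
    also have "\<dots> \<in> sets M"
      using cdm by (intro sets.sets_Collect_finite_All) (auto simp: sp)
    finally show ?thesis .
  qed
  ultimately show ?thesis
    by (simp only:) (rule sets.countable_UN'[OF countableI_type], blast)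
qed

lemma \<tau>_pred_measurable:
  assumes "invariant_prob M"
  shows "{x \<in> X. P (\<tau> n x)} \<in> sets M"
  using assms by (rule cylinder_measurable[where n = n]) (metis \<tau>_cong)

lemma \<tau>_measurable:
  assumes "invariant_prob M"
  shows "\<tau> n \<in> measurable M (count_space UNIV)"
  unfolding measurable_count_space_eq2_countable
proof (intro conjI ballI)
  have sp: "space M = X" using assms by (simp add: invariant_prob_def)
  fix k
  have "\<tau> n -` {k} \<inter> space M = {x \<in> X. \<tau> n x = k}" using sp by auto
  then show "\<tau> n -` {k} \<inter> space M \<in> sets M"
    using \<tau>_pred_measurable[OF assms, of "\<lambda>j. j = k"] by simp
qed auto

lemma rates_measurable:
  assumes "invariant_prob M"
  shows "lower_rate \<in> borel_measurable M" "upper_rate \<in> borel_measurable M"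
proof -
  note [measurable] = \<tau>_measurable[OF assms]
  have "(\<lambda>x. liminf (\<lambda>n. ereal (real (\<tau> n x) / real n))) \<in> borel_measurable M"
    by measurable
  then show "lower_rate \<in> borel_measurable M" by (simp add: lower_rate_eq[abs_def])
  have "(\<lambda>x. limsup (\<lambda>n. ereal (real (\<tau> n x) / real n))) \<in> borel_measurable M"
    by measurable
  then show "upper_rate \<in> borel_measurable M" by (simp add: upper_rate_eq[abs_def])
qed

lemma measure_funpow_vimage:
  assumes "invariant_prob M" "{x \<in> X. P x} \<in> sets M"
  shows "{x \<in> X. P ((T ^^ j) x)} \<in> sets M \<and> measure M {x \<in> X. P ((T ^^ j) x)} = measure M {x \<in> X. P x}"
proof (induction j)
  case (Suc j)
  have M: "space M = X" "T \<in> measurable M M" "distr M M T = M"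
    using assms(1) by (auto simp: invariant_prob_def)
  have eq: "{x \<in> X. P ((T ^^ Suc j) x)} = T -` {x \<in> X. P ((T ^^ j) x)} \<inter> space M"
    unfolding M(1) by (auto simp: T_in funpow_swap1)
  have "measure M {x \<in> X. P ((T ^^ j) x)} = measure (distr M M T) {x \<in> X. P ((T ^^ j) x)}"
    by (simp add: M(3))
  also have "\<dots> = measure M {x \<in> X. P ((T ^^ Suc j) x)}"
    unfolding eq using M Suc by (intro measure_distr) auto
  finally show ?case using Suc M unfolding eq by (auto intro: measurable_sets)
qed (use assms in auto)

text \<open>By invariance each of the \<open>N\<close> times contributes the same measure. A bound
  on visit counts that holds at every point therefore becomes a bound on the measure, the same for
  all invariant probabilities.\<close>

lemma integral_visits:
  assumes "invariant_prob M" "{x \<in> X. P x} \<in> sets M"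
  shows "integrable M (\<lambda>x. real (card {j. j < N \<and> P ((T ^^ j) x)}))"
    and "(\<integral>x. real (card {j. j < N \<and> P ((T ^^ j) x)}) \<partial>M) = real N * measure M {x \<in> X. P x}"
proof -
  interpret prob_space M using assms(1) by (simp add: invariant_prob_def)
  have sp: "space M = X" using assms(1) by (simp add: invariant_prob_def)
  note A = measure_funpow_vimage[OF assms]
  have eq: "real (card {j. j < N \<and> P ((T ^^ j) x)})
      = (\<Sum>j<N. indicator {x \<in> X. P ((T ^^ j) x)} x)" if "x \<in> space M" for x
  proof -
    have "(\<Sum>j<N. indicator {x \<in> X. P ((T ^^ j) x)} x) = (\<Sum>j<N. if P ((T ^^ j) x) then 1 else (0::real))"
      using that sp by (intro sum.cong) auto
    also have "\<dots> = (\<Sum>j\<in>{j\<in>{..<N}. P ((T ^^ j) x)}. 1)"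
      by (rule sum.inter_filter[symmetric]) auto
    finally show ?thesis by simp
  qed
  have int: "integrable M (\<lambda>x. \<Sum>j<N. indicator {x \<in> X. P ((T ^^ j) x)} x :: real)"
    using A by (intro Bochner_Integration.integrable_sum) (auto simp: integrable_indicator_iff emeasure_eq_measure)
  then show "integrable M (\<lambda>x. real (card {j. j < N \<and> P ((T ^^ j) x)}))"
    by (subst Bochner_Integration.integrable_cong[OF refl eq])
  have "(\<integral>x. real (card {j. j < N \<and> P ((T ^^ j) x)}) \<partial>M)
      = (\<integral>x. (\<Sum>j<N. indicator {x \<in> X. P ((T ^^ j) x)} x) \<partial>M)"
    by (rule Bochner_Integration.integral_cong[OF refl eq])
  also have "\<dots> = (\<Sum>j<N. \<integral>x. indicator {x \<in> X. P ((T ^^ j) x)} x \<partial>M)"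
    using A by (intro Bochner_Integration.integral_sum) (auto simp: integrable_indicator_iff emeasure_eq_measure)
  also have "\<dots> = (\<Sum>j<N. measure M {x \<in> X. P x})"
    using A sp by (intro sum.cong) (auto simp: Int_absorb2 sets.sets_into_space)
  finally show "(\<integral>x. real (card {j. j < N \<and> P ((T ^^ j) x)}) \<partial>M) = real N * measure M {x \<in> X. P x}"
    by simp
qed

lemma measure_le_visits:
  assumes "invariant_prob M" "{x \<in> X. P x} \<in> sets M"
    and "\<And>x. x \<in> X \<Longrightarrow> real (card {j. j < N \<and> P ((T ^^ j) x)}) \<le> K"
  shows "real N * measure M {x \<in> X. P x} \<le> K"
proof -
  interpret prob_space M using assms(1) by (simp add: invariant_prob_def)
  have "space M = X" using assms(1) by (simp add: invariant_prob_def)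
  then show ?thesis unfolding integral_visits(2)[OF assms(1,2), symmetric]
    using assms(3) by (intro integral_le_const integral_visits(1) assms(1,2)) auto
qed

lemma measure_ge_visits:
  assumes "invariant_prob M" "{x \<in> X. P x} \<in> sets M"
    and "\<And>x. x \<in> X \<Longrightarrow> K \<le> real (card {j. j < N \<and> P ((T ^^ j) x)})"
  shows "K \<le> real N * measure M {x \<in> X. P x}"
proof -
  interpret prob_space M using assms(1) by (simp add: invariant_prob_def)
  have "space M = X" using assms(1) by (simp add: invariant_prob_def)
  then show ?thesis unfolding integral_visits(2)[OF assms(1,2), symmetric]
    using assms(3) by (intro integral_ge_const integral_visits(1) assms(1,2)) auto
qed

lemma crosses_frac: "crosses a q (frac s + y) \<longleftrightarrow> crosses a q (s + y)"
proof -
  have "frac s + y = s + y - of_int \<lfloor>s\<rfloor>" by (simp add: frac_def)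
  moreover have "s + y - of_int \<lfloor>s\<rfloor> + real q * a = s + y + real q * a - of_int \<lfloor>s\<rfloor>" by simp
  ultimately show ?thesis unfolding crosses_def by (simp only: floor_diff_of_int) auto
qed

text \<open>A return time above \<open>q\<close> requires a crossing at one of the
  \<open>n + 1\<close> times up to \<open>n\<close>. Each occurs with frequency at most
  \<open>dist_int (q * \<alpha>) + 4 / N\<close>, and \<open>N\<close> can be taken arbitrarily
  large.\<close>

lemma measure_\<tau>_le:
  assumes M: "invariant_prob M" and "1 \<le> q"
  shows "1 - real (n + 1) * dist_int (real q * \<alpha>) \<le> measure M {x \<in> X. \<tau> n x \<le> q}"
proof -
  interpret prob_space M using M by (simp add: invariant_prob_def)
  have sp: "space M = X" using M by (simp add: invariant_prob_def)
  define d where "d = dist_int (real q * \<alpha>)"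
  define b where "b = measure M {x \<in> X. \<not> \<tau> n x \<le> q}"
  have key: "real N * b \<le> real (n + 1) * (real N * d + 4)" if N: "equidistributing \<alpha> N" for N
    unfolding b_def
  proof (rule measure_le_visits[OF M \<tau>_pred_measurable[OF M]])
    fix x assume x: "x \<in> X"
    obtain t where t: "codes (n + N) t x" using obtain_codes[OF x] .
    have sub: "{j. j < N \<and> \<not> \<tau> n ((T ^^ j) x) \<le> q}
      \<subseteq> (\<Union>i\<in>{..n}. {j. j < N \<and> crosses \<alpha> q ((t + real i * \<alpha>) + real j * \<alpha>)})"
    proof
      fix j assume j: "j \<in> {j. j < N \<and> \<not> \<tau> n ((T ^^ j) x) \<le> q}"
      have "codes (n + j) t x" using t j by (auto simp: codes_def)
      then have cj: "codes n (frac (t + real j * \<alpha>)) ((T ^^ j) x)" by (rule codes_funpow[OF x])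
      have "q \<notin> return_times \<alpha> n (frac (t + real j * \<alpha>))"
        using \<tau>_le[OF funpow_in[OF x] cj] j by auto
      then obtain i where "i \<le> n" "crosses \<alpha> q (frac (t + real j * \<alpha>) + real i * \<alpha>)"
        using not_crosses_return_time[OF _ \<open>1 \<le> q\<close>, of "frac (t + real j * \<alpha>)" n \<alpha>]
        by (auto simp: frac_lt_1)
      then have "i \<le> n" "crosses \<alpha> q ((t + real i * \<alpha>) + real j * \<alpha>)"
        by (simp_all only: crosses_frac) (simp add: add_ac)
      then show "j \<in> (\<Union>i\<in>{..n}. {j. j < N \<and> crosses \<alpha> q ((t + real i * \<alpha>) + real j * \<alpha>)})"
        using j by auto
    qed
    have "card {j. j < N \<and> \<not> \<tau> n ((T ^^ j) x) \<le> q}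
      \<le> card (\<Union>i\<in>{..n}. {j. j < N \<and> crosses \<alpha> q ((t + real i * \<alpha>) + real j * \<alpha>)})"
      using sub by (intro card_mono) auto
    also have "\<dots> \<le> (\<Sum>i\<in>{..n}. card {j. j < N \<and> crosses \<alpha> q ((t + real i * \<alpha>) + real j * \<alpha>)})"
      by (rule card_UN_le) auto
    also have "real \<dots> \<le> (\<Sum>i\<in>{..n}. real N * d + 4)"
      unfolding of_nat_sum d_def by (intro sum_mono card_crosses(1) N)
    finally show "real (card {j. j < N \<and> \<not> \<tau> n ((T ^^ j) x) \<le> q}) \<le> real (n + 1) * (real N * d + 4)"
      by simp
  qed
  have "b \<le> real (n + 1) * d"
  proof (rule ccontr)
    assume "\<not> b \<le> real (n + 1) * d"
    then have pos: "0 < b - real (n + 1) * d" by simp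
    \<comment> \<open>This \<open>N\<close> is large enough for the counting error
      \<open>4 * (n + 1) / N\<close> to drop below the supposed excess of \<open>b\<close>.\<close>
    obtain N where N: "nat \<lceil>4 * real (n + 1) / (b - real (n + 1) * d)\<rceil> < N" "equidistributing \<alpha> N"
      using dirichlet_large[OF \<alpha>(3)] by metis
    then have "4 * real (n + 1) / (b - real (n + 1) * d) < real N" by linarith
    then have "4 * real (n + 1) < real N * (b - real (n + 1) * d)" using pos by (simp add: field_simps)
    then show False using key[OF N(2)] by (simp add: algebra_simps)
  qed
  moreover have "b = 1 - measure M {x \<in> X. \<tau> n x \<le> q}"
  proof -
    have "{x \<in> X. \<not> \<tau> n x \<le> q} = space M - {x \<in> X. \<tau> n x \<le> q}" using sp by auto
    then show ?thesis unfolding b_def using \<tau>_pred_measurable[OF M, of "\<lambda>k. k \<le> q"] prob_compl by simp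
  qed
  ultimately show ?thesis by (simp add: d_def)
qed

text \<open>A crossing at a time up to \<open>m\<close> forces a return strictly better than
  \<open>q\<close>, hence a time at least \<open>q'\<close>. These \<open>m + 1\<close> events
  exclude each other, so their frequencies add up.\<close>

lemma measure_\<tau>_ge:
  assumes M: "invariant_prob M" and "1 \<le> q"
    and best: "\<And>j. 1 \<le> j \<Longrightarrow> j < q' \<Longrightarrow> dist_int (real q * \<alpha>) \<le> dist_int (real j * \<alpha>)"
    and m: "m < q'"
  shows "real (m + 1) * dist_int (real q * \<alpha>) \<le> measure M {x \<in> X. q' \<le> \<tau> (m + q) x}"
proof -
  define d where "d = dist_int (real q * \<alpha>)"
  define n where "n = m + q"
  define b where "b = measure M {x \<in> X. q' \<le> \<tau> n x}"
  have key: "real (m + 1) * (real N * d - 4) \<le> real N * b" if N: "equidistributing \<alpha> N" for N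
    unfolding b_def
  proof (rule measure_ge_visits[OF M \<tau>_pred_measurable[OF M]])
    fix x assume x: "x \<in> X"
    obtain t where t: "codes (n + N) t x" using obtain_codes[OF x] .
    define A where "A i = {j. j < N \<and> crosses \<alpha> q ((t + real i * \<alpha>) + real j * \<alpha>)}" for i :: nat
    have A_iff: "j \<in> A i \<longleftrightarrow> j < N \<and> crosses \<alpha> q ((t + real j * \<alpha>) + real i * \<alpha>)" for i j
      by (simp add: A_def add_ac)
    have sub: "(\<Union>i\<in>{..m}. A i) \<subseteq> {j. j < N \<and> q' \<le> \<tau> n ((T ^^ j) x)}"
    proof
      fix j assume "j \<in> (\<Union>i\<in>{..m}. A i)"
      then obtain i where i: "i \<le> m" "j < N" "crosses \<alpha> q ((t + real j * \<alpha>) + real i * \<alpha>)"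
        using A_iff by blast
      have "codes (n + j) t x" using t i by (auto simp: codes_def)
      then have cj: "codes n (frac (t + real j * \<alpha>)) ((T ^^ j) x)" by (rule codes_funpow[OF x])
      define k where "k = \<tau> n ((T ^^ j) x)"
      have k: "k \<in> return_times \<alpha> n (frac (t + real j * \<alpha>))"
        unfolding k_def by (rule \<tau>_in_return_times[OF funpow_in[OF x] cj])
      have "dist_int (real k * \<alpha>) < d"
        unfolding d_def by (rule crosses_return_time[OF _ _ k, of q i]) (use i in \<open>auto simp: crosses_frac n_def\<close>)
      moreover have "1 \<le> k" using k by (simp add: return_times_def)
      ultimately have "q' \<le> k" using best[of k] unfolding d_def by linarith
      then show "j \<in> {j. j < N \<and> q' \<le> \<tau> n ((T ^^ j) x)}" using i by (simp add: k_def)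
    qed
    \<comment> \<open>Two crossings at times up to \<open>m\<close> would differ by less than
      \<open>q'\<close>, contradicting the optimality of \<open>q\<close> below
      \<open>q'\<close>.\<close>
    have disj: "A i \<inter> A l = {}" if "i \<in> {..m}" "l \<in> {..m}" "i \<noteq> l" for i l
    proof -
      have "A i \<inter> A l = {}" if "i < l" "l \<le> m" for i l
      proof (rule ccontr)
        assume "A i \<inter> A l \<noteq> {}"
        then obtain j where "j \<in> A i" "j \<in> A l" by blast
        then have "dist_int (real (l - i) * \<alpha>) < d"
          unfolding d_def A_iff using crosses_disjoint that(1) by blast
        moreover have "d \<le> dist_int (real (l - i) * \<alpha>)"
          unfolding d_def using that m by (intro best) auto
        ultimately show False by simp
      qed
      from this[of i l] this[of l i] that show ?thesis by (auto simp: nat_neq_iff)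
    qed
    have "real (m + 1) * (real N * d - 4) = (\<Sum>i\<in>{..m}. real N * d - 4)" by simp
    also have "\<dots> \<le> (\<Sum>i\<in>{..m}. real (card (A i)))"
      unfolding A_def d_def by (intro sum_mono card_crosses(2) N)
    also have "\<dots> = real (card (\<Union>i\<in>{..m}. A i))"
      using disj by (subst card_UN_disjoint) (auto simp: A_def)
    also have "\<dots> \<le> real (card {j. j < N \<and> q' \<le> \<tau> n ((T ^^ j) x)})"
      using sub by (intro of_nat_mono card_mono) auto
    finally show "real (m + 1) * (real N * d - 4) \<le> real (card {j. j < N \<and> q' \<le> \<tau> n ((T ^^ j) x)})" .
  qed
  have "real (m + 1) * d \<le> b"
  proof (rule ccontr)
    assume "\<not> real (m + 1) * d \<le> b"
    then have pos: "0 < real (m + 1) * d - b" by simp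
    obtain N where N: "nat \<lceil>4 * real (m + 1) / (real (m + 1) * d - b)\<rceil> < N" "equidistributing \<alpha> N"
      using dirichlet_large[OF \<alpha>(3)] by metis
    then have "4 * real (m + 1) / (real (m + 1) * d - b) < real N" by linarith
    then have "4 * real (m + 1) < real N * (real (m + 1) * d - b)" using pos by (simp add: field_simps)
    then show False using key[OF N(2)] by (simp add: algebra_simps)
  qed
  then show ?thesis by (simp add: d_def b_def n_def)
qed

text \<open>\<open>F\<close> and its preimage have equal measure and one contains the other, so they
  agree almost everywhere. Conditioning on an almost invariant set preserves invariance.\<close>

lemma invariant_uniform_measure:
  assumes M: "invariant_prob M" and F: "F \<in> sets M" "measure M F > 0"
    and one_sided: "(\<forall>x\<in>X. x \<in> F \<longrightarrow> T x \<in> F) \<or> (\<forall>x\<in>X. T x \<in> F \<longrightarrow> x \<in> F)"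
  shows "invariant_prob (uniform_measure M F)"
proof -
  interpret prob_space M using M by (simp add: invariant_prob_def)
  have sp: "space M = X" and T[measurable]: "T \<in> measurable M M" and inv: "distr M M T = M"
    using M by (auto simp: invariant_prob_def)
  note [measurable] = F(1)
  define F' where "F' = T -` F \<inter> space M"
  have F'[measurable]: "F' \<in> sets M" unfolding F'_def by measurable
  have "measure M F' = measure (distr M M T) F" unfolding F'_def by (simp add: measure_distr)
  then have meas: "measure M F' = measure M F" by (simp add: inv)
  have "F \<subseteq> F' \<or> F' \<subseteq> F"
    using one_sided sets.sets_into_space[OF F(1)] sp by (auto simp: F'_def)
  then have "measure M (F - F') = 0" "measure M (F' - F) = 0"
    using meas finite_measure_Diff[of F F'] finite_measure_Diff[of F' F] F(1) F'
    by (auto simp: Diff_eq_empty_iff[THEN iffD2])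
  then have "AE x in M. x \<notin> F - F'" "AE x in M. x \<notin> F' - F"
    using F(1) F' by (intro AE_not_in; simp add: null_sets_def emeasure_eq_measure)+
  then have ae: "AE x in M. x \<in> F \<longleftrightarrow> T x \<in> F"
    using AE_space by eventually_elim (auto simp: F'_def)
  have emF: "emeasure M F \<noteq> 0" "emeasure M F \<noteq> \<infinity>" using F(2) by (auto simp: emeasure_eq_measure)
  let ?U = "uniform_measure M F"
  have TU: "T \<in> measurable ?U ?U" using T by (simp cong: measurable_cong_sets)
  have "distr ?U ?U T = ?U"
  proof (rule measure_eqI)
    fix A assume "A \<in> sets (distr ?U ?U T)"
    then have A[measurable]: "A \<in> sets M" by simp
    have "emeasure (distr ?U ?U T) A = emeasure ?U (T -` A \<inter> space M)"
      using A TU by (subst emeasure_distr) auto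
    also have "\<dots> = emeasure M (F \<inter> (T -` A \<inter> space M)) / emeasure M F"
      using F(1) by (subst emeasure_uniform_measure) auto
    \<comment> \<open>Up to a null set, \<open>F\<close> is replaced by its preimage, so the
      intersection becomes the preimage of \<open>F \<inter> A\<close>.\<close>
    also have "emeasure M (F \<inter> (T -` A \<inter> space M)) = emeasure M (T -` (F \<inter> A) \<inter> space M)"
      using ae by (intro emeasure_eq_AE) auto
    also have "\<dots> = emeasure (distr M M T) (F \<inter> A)"
      by (subst emeasure_distr) auto
    also have "\<dots> / emeasure M F = emeasure ?U A" by (simp add: inv F(1) A)
    finally show "emeasure (distr ?U ?U T) A = emeasure ?U A" .
  qed simp
  moreover have "prob_space ?U" using emF by (rule prob_space_uniform_measure)
  ultimately show ?thesis using M TU sp unfolding invariant_prob_def by auto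
qed

text \<open>If \<open>F\<close> had positive measure, conditioning on it would give another invariant probability,
  for which the same frequency estimates hold. This replaces an appeal to ergodicity.\<close>

lemma AE_not_in_semi_invariant:
  assumes M: "invariant_prob M" and F: "F \<in> sets M" and "c > 0"
    and one_sided: "(\<forall>x\<in>X. x \<in> F \<longrightarrow> T x \<in> F) \<or> (\<forall>x\<in>X. T x \<in> F \<longrightarrow> x \<in> F)"
    and avoids: "\<And>x. x \<in> F \<Longrightarrow> eventually (\<lambda>n. \<not> R n (\<tau> n x)) sequentially"
    and often: "\<And>M m. invariant_prob M \<Longrightarrow> \<exists>n>m. c \<le> measure M {x \<in> X. R n (\<tau> n x)}"
  shows "AE x in M. x \<notin> F"
proof (rule ccontr)
  assume not: "\<not> (AE x in M. x \<notin> F)"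
  interpret prob_space M using M by (simp add: invariant_prob_def)
  have "measure M F > 0"
  proof (rule ccontr)
    assume "\<not> measure M F > 0"
    then have "measure M F = 0" using measure_nonneg[of M F] by simp
    then have "AE x in M. x \<notin> F" using F by (intro AE_not_in) (auto simp: null_sets_def emeasure_eq_measure)
    then show False using not by simp
  qed
  then have U: "invariant_prob (uniform_measure M F)"
    using invariant_uniform_measure[OF M F _ one_sided] by simp
  then interpret U: prob_space "uniform_measure M F" by (simp add: invariant_prob_def)
  have sp: "space (uniform_measure M F) = X" using U by (simp only: invariant_prob_def)
  have "AE x in uniform_measure M F. eventually (\<lambda>n. \<not> R n (\<tau> n x)) sequentially"
    by (rule AE_uniform_measureI[OF F], rule AE_I2, rule impI, rule avoids)
  moreover have "\<not> (AE x in uniform_measure M F. eventually (\<lambda>n. \<not> R n (\<tau> n x)) sequentially)"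
  proof (rule U.not_eventually_avoids[OF _ \<open>c > 0\<close>])
    show "{x \<in> space (uniform_measure M F). R n (\<tau> n x)} \<in> sets (uniform_measure M F)" for n
      unfolding sp by (rule \<tau>_pred_measurable[OF U])
    show "\<exists>n>m. c \<le> measure (uniform_measure M F) {x \<in> space (uniform_measure M F). R n (\<tau> n x)}" for m
      unfolding sp by (rule often[OF U])
  qed
  ultimately show False by contradiction
qed

text \<open>By \<open>lower_rate_T\<close> the exceptional set contains \<open>x\<close> whenever it
  contains \<open>T x\<close>; on it \<open>\<tau> n x > r * n\<close> holds eventually.\<close>

lemma AE_lower_rate_le:
  assumes M: "invariant_prob M" and "c > 0"
    and often: "\<And>M m. invariant_prob M \<Longrightarrow> \<exists>n>m. c \<le> measure M {x \<in> X. real (\<tau> n x) \<le> r * real n}"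
  shows "AE x in M. lower_rate x \<le> ereal r"
proof -
  have sp: "space M = X" using M by (simp add: invariant_prob_def)
  note [measurable] = rates_measurable[OF M]
  define F where "F = {x \<in> space M. ereal r < lower_rate x}"
  have F: "F \<in> sets M" unfolding F_def by measurable
  have "AE x in M. x \<notin> F"
    using M F \<open>c > 0\<close> _ _ often
  proof (rule AE_not_in_semi_invariant)
    show "(\<forall>x\<in>X. x \<in> F \<longrightarrow> T x \<in> F) \<or> (\<forall>x\<in>X. T x \<in> F \<longrightarrow> x \<in> F)"
      using lower_rate_T by (auto simp: F_def sp)
    fix x assume "x \<in> F"
    then have "ereal r < liminf (\<lambda>n. ereal (real (\<tau> n x) / real n))" by (simp add: F_def lower_rate_eq)
    then have "eventually (\<lambda>n. ereal r < ereal (real (\<tau> n x) / real n)) sequentially" by (rule less_LiminfD)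
    then show "eventually (\<lambda>n. \<not> real (\<tau> n x) \<le> r * real n) sequentially"
      using eventually_ge_at_top[of 1]
      by eventually_elim (auto simp: field_simps)
  qed
  then show ?thesis using AE_space by eventually_elim (auto simp: F_def not_less)
qed

text \<open>Dual to the previous lemma: by \<open>upper_rate_T\<close> the exceptional set is now
  forward invariant.\<close>

lemma AE_upper_rate_ge:
  assumes M: "invariant_prob M" and "c > 0"
    and often: "\<And>M m. invariant_prob M \<Longrightarrow> \<exists>n>m. c \<le> measure M {x \<in> X. r * real n \<le> real (\<tau> n x)}"
  shows "AE x in M. ereal r \<le> upper_rate x"
proof -
  have sp: "space M = X" using M by (simp add: invariant_prob_def)
  note [measurable] = rates_measurable[OF M]
  define F where "F = {x \<in> space M. upper_rate x < ereal r}"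
  have F: "F \<in> sets M" unfolding F_def by measurable
  have "AE x in M. x \<notin> F"
    using M F \<open>c > 0\<close> _ _ often
  proof (rule AE_not_in_semi_invariant)
    show "(\<forall>x\<in>X. x \<in> F \<longrightarrow> T x \<in> F) \<or> (\<forall>x\<in>X. T x \<in> F \<longrightarrow> x \<in> F)"
      using upper_rate_T T_in by (auto simp: F_def sp)
    fix x assume "x \<in> F"
    then have "limsup (\<lambda>n. ereal (real (\<tau> n x) / real n)) < ereal r" by (simp add: F_def upper_rate_eq)
    then have "eventually (\<lambda>n. ereal (real (\<tau> n x) / real n) < ereal r) sequentially" by (rule Limsup_lessD)
    then show "eventually (\<lambda>n. \<not> r * real n \<le> real (\<tau> n x)) sequentially"
      using eventually_ge_at_top[of 1]
      by eventually_elim (auto simp: field_simps)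
  qed
  then show ?thesis using AE_space by eventually_elim (auto simp: F_def not_less)
qed

end

section \<open>Recurrence rates\<close>

text \<open>Asking for a product also below every \<open>dist_int (j * a)\<close> with
  \<open>j \<le> Suc m\<close> excludes small \<open>k\<close>, so violations of bad approximability
  occur at arbitrarily large \<open>k\<close>.\<close>

lemma not_badly_approximable:
  assumes "a \<notin> \<rat>" "\<not> badly_approximable a" "c > 0"
  obtains k where "m < k" "real k * dist_int (real k * a) < c"
proof -
  obtain q where q: "1 \<le> q" "q \<le> Suc m"
    "\<forall>j. 1 \<le> j \<longrightarrow> j \<le> Suc m \<longrightarrow> dist_int (real q * a) \<le> dist_int (real j * a)"
    by (rule best_approximation[OF assms(1), of "Suc m"]) auto
  have "0 < min c (dist_int (real q * a))" using dist_int_pos[OF assms(1) q(1)] assms(3) by simp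
  then obtain k where k: "1 \<le> k" "real k * dist_int (real k * a) < min c (dist_int (real q * a))"
    using assms(2) unfolding badly_approximable_def not_ex de_Morgan_conj not_all not_imp not_le
    by blast
  have "m < k"
  proof (rule ccontr)
    assume "\<not> m < k"
    then have "dist_int (real q * a) \<le> dist_int (real k * a)" using k(1) by (intro q(3)[rule_format]) auto
    also have "\<dots> \<le> real k * dist_int (real k * a)"
      using k(1) dist_int_nonneg[of "real k * a"] mult_right_mono[of 1 "real k"] by simp
    finally show False using k(2) by simp
  qed
  moreover have "real k * dist_int (real k * a) < c" using k(2) by simp
  ultimately show ?thesis by (rule that)
qed

text \<open>The difference \<open>q' - q\<close> has error at most \<open>2 * d\<close>, so bad
  approximability bounds it below by \<open>c / (2 * d)\<close>; and
  \<open>q' * d \<le> 2\<close>.\<close>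

lemma badly_approximable_gap:
  assumes irr: "a \<notin> \<rat>" and "c > 0"
    and c: "\<And>k. 1 \<le> k \<Longrightarrow> c \<le> real k * dist_int (real k * a)"
  obtains q q' where "1 \<le> q" "q < q'" "m < q'" "c * real q' \<le> 4 * real (q' - q)"
    "\<forall>j. 1 \<le> j \<longrightarrow> j < q' \<longrightarrow> dist_int (real q * a) \<le> dist_int (real j * a)"
    "real (q' - 1) * dist_int (real q * a) < 1"
    "1 \<le> 2 * real q' * dist_int (real q * a)"
proof -
  obtain q q' where q: "1 \<le> q" "q \<le> Suc m" "Suc m < q'"
    "\<forall>j. 1 \<le> j \<longrightarrow> j < q' \<longrightarrow> dist_int (real q * a) \<le> dist_int (real j * a)"
    "dist_int (real q' * a) < dist_int (real q * a)"
    "real (q' - 1) * dist_int (real q * a) < 1"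
    "1 \<le> 2 * real q' * dist_int (real q * a)"
    using consecutive_best_approximations[OF irr, of "Suc m"] by auto
  have less: "q < q'" using q by simp
  define d where "d = dist_int (real q * a)"
  have d0: "0 \<le> d" by (simp add: d_def dist_int_nonneg)
  have "dist_int (real (q' - q) * a) \<le> dist_int (real q' * a) + dist_int (- (real q * a))"
    using dist_int_add[of "real q' * a" "- (real q * a)"] less by (simp add: of_nat_diff algebra_simps)
  also have "\<dots> \<le> 2 * d" using q(5) by (simp add: dist_int_minus d_def)
  finally have le: "dist_int (real (q' - q) * a) \<le> 2 * d" .
  have "c \<le> real (q' - q) * dist_int (real (q' - q) * a)" using less by (intro c) auto
  also have "\<dots> \<le> real (q' - q) * (2 * d)" using le by (intro mult_left_mono) auto
  finally have c2: "c \<le> 2 * real (q' - q) * d" by simp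
  have "real q' * d \<le> 2 * (real (q' - 1) * d)"
  proof -
    have "real q' \<le> 2 * real (q' - 1)" using q by (simp add: of_nat_diff)
    then have "real q' * d \<le> (2 * real (q' - 1)) * d" using d0 by (intro mult_right_mono)
    then show ?thesis by simp
  qed
  also have "\<dots> \<le> 2" using q(6) by (simp add: d_def)
  finally have qd: "real q' * d \<le> 2" .
  have "c * real q' \<le> (2 * real (q' - q) * d) * real q'" using c2 by (intro mult_right_mono) auto
  also have "\<dots> = 2 * real (q' - q) * (real q' * d)" by simp
  also have "\<dots> \<le> 2 * real (q' - q) * 2" using qd by (intro mult_left_mono) auto
  finally have "c * real q' \<le> 4 * real (q' - q)" by simp
  then show ?thesis using q less by (intro that[of q q']) auto
qed

text \<open>The length \<open>n\<close> lies about halfway between \<open>q\<close> and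
  \<open>q'\<close>, away from both by a definite proportion. At this one length
  \<open>\<tau> n \<le> q < n\<close> and \<open>\<tau> n \<ge> q' > n\<close> each have measure at
  least \<open>g / 4\<close>.\<close>

lemma badly_approximable_scale:
  assumes irr: "a \<notin> \<rat>" and "c > 0"
    and c: "\<And>k. 1 \<le> k \<Longrightarrow> c \<le> real k * dist_int (real k * a)"
    and g_def: "g = c / 4"
  obtains n q l q' where "m < n" "1 \<le> q" "l < q'" "n = l + q"
    "\<forall>j. 1 \<le> j \<longrightarrow> j < q' \<longrightarrow> dist_int (real q * a) \<le> dist_int (real j * a)"
    "real n \<le> (1 - g / 2) * real q'" "real q \<le> (1 - g / 4) * real n"
    "g / 4 \<le> real (l + 1) * dist_int (real q * a)"
    "real (n + 1) * dist_int (real q * a) \<le> 1 - g / 4"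
proof -
  have "c \<le> 1" using c[of 1] dist_int_le_1[of a] by simp
  then have g: "0 < g" "g \<le> 1/4" using \<open>c > 0\<close> by (auto simp: g_def)
  \<comment> \<open>In the threshold, \<open>2 * m\<close> secures \<open>m < n\<close>, and
    \<open>8 / g\<close> makes \<open>g * q'\<close> exceed 8 to absorb the rounding in
    \<open>l\<close> and the shifts by 1.\<close>
  obtain q q' where q: "1 \<le> q" "q < q'" "2 * m + nat \<lceil>8 / g\<rceil> < q'" "c * real q' \<le> 4 * real (q' - q)"
    "\<forall>j. 1 \<le> j \<longrightarrow> j < q' \<longrightarrow> dist_int (real q * a) \<le> dist_int (real j * a)"
    "real (q' - 1) * dist_int (real q * a) < 1"
    "1 \<le> 2 * real q' * dist_int (real q * a)"
    using badly_approximable_gap[OF irr \<open>c > 0\<close> c, of "2 * m + nat \<lceil>8 / g\<rceil>"] .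
  define d where "d = dist_int (real q * a)"
  have "0 < d" using dist_int_pos[OF irr q(1)] by (simp add: d_def)
  define l n where "l = (q' - q) div 2" and "n = l + q"
  have gq: "g * real q' \<le> real q' - real q" using q(2,4) by (simp add: g_def of_nat_diff)
  have "8 / g < real q'" using q(3) by linarith
  then have big: "8 < g * real q'" using g by (simp add: field_simps)
  have l: "real q' - real q - 1 \<le> 2 * real l" "2 * real l \<le> real q' - real q"
    using q(2) by (auto simp: l_def)
  have nq: "real n = real l + real q" by (simp add: n_def)
  have n1: "real n \<le> (1 - g / 2) * real q'" using l gq by (simp add: nq algebra_simps)
  have "real n \<le> real q'" using l q(2) by (simp add: nq)
  then have "g * real n \<le> g * real q'" using g by simp
  then have n2: "real q \<le> (1 - g / 4) * real n" using l gq big by (simp add: nq algebra_simps)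
  have n3: "g / 4 \<le> real (l + 1) * d"
  proof -
    have "g * real q' \<le> 2 * real (l + 1)" using l gq by simp
    then have "g * real q' * d \<le> 2 * real (l + 1) * d" using \<open>0 < d\<close> by (intro mult_right_mono) auto
    moreover have "g * 1 \<le> g * (2 * real q' * d)" using q(7) g by (intro mult_left_mono) (auto simp: d_def)
    ultimately show ?thesis by (simp add: algebra_simps)
  qed
  have n4: "real (n + 1) * d \<le> 1 - g / 4"
  proof -
    have "real (n + 1) \<le> (1 - g / 4) * real (q' - 1)"
    proof -
      have "(1 - g / 4) * real (q' - 1) = real q' - 1 - (g * real q') / 4 + g / 4"
        using q(1,2) by (simp add: of_nat_diff algebra_simps diff_divide_distrib)
      moreover have "real n \<le> real q' - (g * real q') / 2" using n1 by (simp add: algebra_simps)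
      ultimately show ?thesis using big g(1) by (simp only: of_nat_add of_nat_1)
    qed
    then have "real (n + 1) * d \<le> (1 - g / 4) * real (q' - 1) * d"
      using less_imp_le[OF \<open>0 < d\<close>] by (rule mult_right_mono)
    also have "\<dots> = (1 - g / 4) * (real (q' - 1) * d)" by simp
    also have "\<dots> \<le> (1 - g / 4) * 1" using q(6) g by (intro mult_left_mono) (auto simp: d_def)
    finally show ?thesis by simp
  qed
  have "2 * real m < 2 * real n" using l q(1,3) by (simp add: nq)
  then have "m < n" by simp
  moreover have "l < q'" using q(2) by (simp add: l_def)
  ultimately show ?thesis using q(1,5) n1 n2 n3 n4 unfolding d_def
    by (intro that[of n q l q']) (simp_all only: n_def)
qed

section \<open>Almost sure bounds on the recurrence rates\<close>

context sturmian_coding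
begin

lemma measure_mono_\<tau>:
  assumes M: "invariant_prob M" and "\<And>k. P k \<Longrightarrow> Q k"
  shows "measure M {x \<in> X. P (\<tau> n x)} \<le> measure M {x \<in> X. Q (\<tau> n x)}"
proof -
  interpret prob_space M using M by (simp add: invariant_prob_def)
  show ?thesis using assms(2) \<tau>_pred_measurable[OF M, of Q n] by (intro finite_measure_mono) auto
qed

text \<open>When \<open>k * dist_int (k * \<alpha>)\<close> is tiny, even a window of length
  \<open>L * k\<close> misses the crossing arc with probability at least \<open>1/2\<close>. Then
  \<open>\<tau> n \<le> k = n / L\<close>, with \<open>L\<close> arbitrary.\<close>

lemma AE_lower_rate_eq_0:
  assumes M: "invariant_prob M" and nb: "\<not> badly_approximable \<alpha>"
  shows "AE x in M. lower_rate x \<le> 0"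
proof -
  have "AE x in M. lower_rate x \<le> ereal (1 / real (Suc i))" for i
  proof (rule AE_lower_rate_le[OF M, of "1/2"])
    fix M m assume M: "invariant_prob M"
    define L where "L = Suc i"
    obtain k where k: "m < k" "real k * dist_int (real k * \<alpha>) < 1 / (2 * real (L + 1))"
      using not_badly_approximable[OF \<alpha>(3) nb, of "1 / (2 * real (L + 1))" m] by auto
    \<comment> \<open>The \<open>n + 1\<close> crossing times number at most
      \<open>(L + 1) * k\<close>, which explains \<open>2 * (L + 1)\<close> in the choice of
      \<open>k\<close>.\<close>
    define n where "n = L * k"
    have "real (n + 1) \<le> real (L + 1) * real k" using k(1) by (simp add: n_def algebra_simps)
    then have "real (n + 1) * dist_int (real k * \<alpha>) \<le> real (L + 1) * real k * dist_int (real k * \<alpha>)"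
      using dist_int_nonneg by (rule mult_right_mono)
    also have "\<dots> \<le> 1 / 2"
    proof -
      have "real k * dist_int (real k * \<alpha>) * (2 * real (L + 1)) < 1"
        using k(2) by (subst (asm) pos_less_divide_eq) simp_all
      then show ?thesis by (simp add: algebra_simps)
    qed
    finally have "1 / 2 \<le> 1 - real (n + 1) * dist_int (real k * \<alpha>)" by simp
    also have "\<dots> \<le> measure M {x \<in> X. \<tau> n x \<le> k}" using k(1) by (intro measure_\<tau>_le M) auto
    also have "\<dots> \<le> measure M {x \<in> X. real (\<tau> n x) \<le> 1 / real (Suc i) * real n}"
    proof (rule measure_mono_\<tau>[OF M])
      have "1 / real (Suc i) * real n = real k" 
        unfolding n_def L_def of_nat_mult by (simp del: of_nat_Suc)
      then show "real j \<le> 1 / real (Suc i) * real n" if "j \<le> k" for j using that by simp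
    qed
    finally have "1 / 2 \<le> measure M {x \<in> X. real (\<tau> n x) \<le> 1 / real (Suc i) * real n}" .
    moreover have "n > m" using k(1) by (simp add: n_def L_def)
    ultimately show "\<exists>n>m. 1 / 2 \<le> measure M {x \<in> X. real (\<tau> n x) \<le> 1 / real (Suc i) * real n}"
      by blast
  qed simp
  then have "AE x in M. \<forall>i. lower_rate x \<le> ereal (1 / real (Suc i))" by (simp add: AE_all_countable)
  then show ?thesis
  proof eventually_elim
    case (elim x)
    have "(\<lambda>i. ereal (1 / real (Suc i))) \<longlonglongrightarrow> ereal 0"
      using LIMSEQ_inverse_real_of_nat by (simp add: inverse_eq_divide)
    then show ?case using elim by (intro LIMSEQ_le_const[where X = "\<lambda>i. ereal (1 / real (Suc i))"]) (auto simp: zero_ereal_def)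
  qed
qed

text \<open>A tiny product at \<open>k\<close> forces \<open>q' \<ge> 4 * K * q\<close>. At length
  \<open>l + q\<close> with \<open>l\<close> about \<open>q' / (4 * K)\<close>, return times of at
  least \<open>q'\<close> have measure at least \<open>1 / (8 * K)\<close>; this depends on
  \<open>K\<close> but not on \<open>m\<close>, as required for each fixed \<open>K\<close>.\<close>

lemma AE_upper_rate_eq_PInfty:
  assumes M: "invariant_prob M" and nb: "\<not> badly_approximable \<alpha>"
  shows "AE x in M. upper_rate x = \<infinity>"
proof -
  have "AE x in M. ereal (real (Suc i)) \<le> upper_rate x" for i
  proof (rule AE_upper_rate_ge[OF M, of "1 / (8 * real (Suc i))"])
    fix M m assume M: "invariant_prob M"
    define K where "K = Suc i"
    \<comment> \<open>The bound \<open>4 * K * (m + 2) < k < q'\<close> keeps \<open>l\<close> above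
      \<open>m\<close> after division by \<open>4 * K\<close>.\<close>
    obtain k where k: "4 * K * (m + 2) < k" "real k * dist_int (real k * \<alpha>) < 1 / (8 * real K)"
      using not_badly_approximable[OF \<alpha>(3) nb, of "1 / (8 * real K)" "4 * K * (m + 2)"] by (auto simp: K_def)
    obtain q q' where q: "1 \<le> q" "q \<le> k" "k < q'"
      "\<forall>j. 1 \<le> j \<longrightarrow> j < q' \<longrightarrow> dist_int (real q * \<alpha>) \<le> dist_int (real j * \<alpha>)"
      "dist_int (real q' * \<alpha>) < dist_int (real q * \<alpha>)"
      "real (q' - 1) * dist_int (real q * \<alpha>) < 1"
      "1 \<le> 2 * real q' * dist_int (real q * \<alpha>)"
    proof (rule consecutive_best_approximations[OF \<alpha>(3), of k])
      show "1 \<le> k" using k(1) by simp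
    qed
    define d where "d = dist_int (real q * \<alpha>)"
    have "0 < d" using dist_int_pos[OF \<alpha>(3) q(1)] by (simp add: d_def)
    have "d \<le> dist_int (real k * \<alpha>)" unfolding d_def using q(1-3) by (intro q(4)[rule_format]) auto
    then have "real q * d \<le> real k * dist_int (real k * \<alpha>)"
      using q(2) \<open>0 < d\<close> by (intro mult_mono) auto
    also note less_imp_le[OF k(2)]
    finally have "real q * d * (8 * real K) \<le> 1"
      by (subst (asm) pos_le_divide_eq) (simp_all add: K_def)
    then have "8 * real K * (real q * d) \<le> 1" by (simp only: mult_ac)
    also have "\<dots> \<le> 2 * real q' * d" using q(7) by (simp add: d_def)
    finally have "(4 * real K * real q) * d \<le> real q' * d" by (simp add: mult_ac)
    then have qq: "4 * real K * real q \<le> real q'" using \<open>0 < d\<close> by simp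
    define l where "l = q' div (4 * K)"
    have l1: "4 * K * l \<le> q'" by (simp add: l_def)
    have l2: "q' < 4 * K * (l + 1)"
      using dividend_less_times_div[of "4 * K" q'] by (simp add: l_def K_def)
    have "4 * real K * real l \<le> real q'" using l1 by (metis of_nat_le_iff of_nat_mult of_nat_numeral)
    then have n: "2 * real K * real (l + q) \<le> real q'" using qq by (simp add: algebra_simps)
    have "4 * K * (m + 2) < 4 * K * (l + 1)" using l2 k(1) q(3) by linarith
    then have "m + 2 < l + 1" by (simp only: mult_less_cancel1)
    then have "l + q > m" by simp
    have "1 \<le> K" "1 \<le> q'" using q by (auto simp: K_def)
    have "l < q'"
    proof -
      have "l \<le> 4 * K * l" by (simp add: K_def)
      moreover have "l \<noteq> 4 * K * l" if "l > 0" using that by (simp add: K_def)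
      ultimately show ?thesis using l1 \<open>1 \<le> q'\<close> by (cases "l = 0") linarith+
    qed
    have "1 / (8 * real K) \<le> real (l + 1) * d"
    proof -
      have "real q' \<le> 4 * real K * real (l + 1)"
        using l2 by (metis less_imp_le of_nat_le_iff of_nat_mult of_nat_numeral)
      then have "2 * real q' * d \<le> 2 * (4 * real K * real (l + 1)) * d"
        using \<open>0 < d\<close> by (intro mult_right_mono) auto
      then have "1 \<le> 8 * real K * (real (l + 1) * d)" using q(7) by (simp add: d_def)
      then show ?thesis using \<open>1 \<le> K\<close> by (simp add: field_simps)
    qed
    also have "\<dots> \<le> measure M {x \<in> X. q' \<le> \<tau> (l + q) x}"
      unfolding d_def using M q(1) q(4)[rule_format] \<open>l < q'\<close> by (rule measure_\<tau>_ge)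
    also have "\<dots> \<le> measure M {x \<in> X. real (Suc i) * real (l + q) \<le> real (\<tau> (l + q) x)}"
    proof (rule measure_mono_\<tau>[OF M])
      fix k assume "q' \<le> k"
      have "real K * real (l + q) \<le> 2 * real K * real (l + q)" by simp
      with n \<open>q' \<le> k\<close> show "real (Suc i) * real (l + q) \<le> real k" unfolding K_def by linarith
    qed
    finally show "\<exists>n>m. 1 / (8 * real (Suc i)) \<le> measure M {x \<in> X. real (Suc i) * real n \<le> real (\<tau> n x)}"
      using \<open>l + q > m\<close> unfolding K_def by blast
  qed simp
  then have "AE x in M. \<forall>i. ereal (real (Suc i)) \<le> upper_rate x" by (simp add: AE_all_countable)
  then show ?thesis
  proof eventually_elim
    case (elim x)
    show ?case
    proof (rule ereal_top)
      fix B :: real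
      obtain i :: nat where "B \<le> real i" using real_arch_simple by blast
      then have "ereal B \<le> ereal (real (Suc i))" by simp
      then show "ereal B \<le> upper_rate x" using elim order_trans by blast
    qed
  qed
qed

lemma AE_rates_badly_approximable:
  assumes M: "invariant_prob M" and "badly_approximable \<alpha>"
  shows "AE x in M. lower_rate x < 1" "AE x in M. 1 < upper_rate x"
proof -
  obtain c where c: "c > 0" "\<And>k. 1 \<le> k \<Longrightarrow> c \<le> real k * dist_int (real k * \<alpha>)"
    using assms(2) unfolding badly_approximable_def by metis
  have "c \<le> 1" using c(2)[of 1] dist_int_le_1[of \<alpha>] by simp
  define g where "g = c / 4"
  have g: "0 < g" "g \<le> 1/4" using c(1) \<open>c \<le> 1\<close> by (auto simp: g_def)
  have "AE x in M. lower_rate x \<le> ereal (1 - g / 4)"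
  proof (rule AE_lower_rate_le[OF M, of "g / 4"])
    fix M m assume M: "invariant_prob M"
    obtain n q l q' where n: "m < n" "1 \<le> q" "l < q'" "n = l + q"
      "\<forall>j. 1 \<le> j \<longrightarrow> j < q' \<longrightarrow> dist_int (real q * \<alpha>) \<le> dist_int (real j * \<alpha>)"
      "real n \<le> (1 - g / 2) * real q'" "real q \<le> (1 - g / 4) * real n"
      "g / 4 \<le> real (l + 1) * dist_int (real q * \<alpha>)"
      "real (n + 1) * dist_int (real q * \<alpha>) \<le> 1 - g / 4"
      using badly_approximable_scale[OF \<alpha>(3) c g_def, of m] .
    have "g / 4 \<le> 1 - real (n + 1) * dist_int (real q * \<alpha>)" using n(9) by simp
    also have "\<dots> \<le> measure M {x \<in> X. \<tau> n x \<le> q}" using M n(2) by (rule measure_\<tau>_le)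
    also have "\<dots> \<le> measure M {x \<in> X. real (\<tau> n x) \<le> (1 - g / 4) * real n}"
      using n(7) by (intro measure_mono_\<tau>[OF M]) linarith
    finally show "\<exists>n>m. g / 4 \<le> measure M {x \<in> X. real (\<tau> n x) \<le> (1 - g / 4) * real n}"
      using n(1) by blast
  qed (use g in simp)
  then show "AE x in M. lower_rate x < 1"
  proof eventually_elim
    case (elim x)
    also have "ereal (1 - g / 4) < 1" using g by (simp add: one_ereal_def)
    finally show ?case .
  qed
  have "AE x in M. ereal (1 / (1 - g / 2)) \<le> upper_rate x"
  proof (rule AE_upper_rate_ge[OF M, of "g / 4"])
    fix M m assume M: "invariant_prob M"
    obtain n q l q' where n: "m < n" "1 \<le> q" "l < q'" "n = l + q"
      "\<forall>j. 1 \<le> j \<longrightarrow> j < q' \<longrightarrow> dist_int (real q * \<alpha>) \<le> dist_int (real j * \<alpha>)"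
      "real n \<le> (1 - g / 2) * real q'" "real q \<le> (1 - g / 4) * real n"
      "g / 4 \<le> real (l + 1) * dist_int (real q * \<alpha>)"
      "real (n + 1) * dist_int (real q * \<alpha>) \<le> 1 - g / 4"
      using badly_approximable_scale[OF \<alpha>(3) c g_def, of m] .
    note n(8)
    also have "real (l + 1) * dist_int (real q * \<alpha>) \<le> measure M {x \<in> X. q' \<le> \<tau> n x}"
      unfolding n(4) using M n(2) n(5)[rule_format] n(3) by (rule measure_\<tau>_ge)
    also have "\<dots> \<le> measure M {x \<in> X. 1 / (1 - g / 2) * real n \<le> real (\<tau> n x)}"
    proof (rule measure_mono_\<tau>[OF M])
      fix k assume "q' \<le> k"
      then have "(1 - g / 2) * real q' \<le> (1 - g / 2) * real k" using g by (intro mult_left_mono) auto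
      then have "real n \<le> (1 - g / 2) * real k" using n(6) by simp
      then show "1 / (1 - g / 2) * real n \<le> real k" using g by (simp add: field_simps)
    qed
    finally show "\<exists>n>m. g / 4 \<le> measure M {x \<in> X. 1 / (1 - g / 2) * real n \<le> real (\<tau> n x)}"
      using n(1) by blast
  qed (use g in simp)
  then show "AE x in M. 1 < upper_rate x"
  proof eventually_elim
    case (elim x)
    have "1 < ereal (1 / (1 - g / 2))" using g by (simp add: one_ereal_def)
    then show ?case using elim by (rule less_le_trans)
  qed
qed

text \<open>In the unbounded case the almost sure values of the rates contradict the assumed bounds,
  since a probability space is not null.\<close>

theorem recurrence_rates:
  assumes M: "invariant_prob M"
  shows "bounded_partial_quotients \<alpha> \<longleftrightarrow> (AE x in M. lower_rate x > 0)"
    and "bounded_partial_quotients \<alpha> \<longleftrightarrow> (AE x in M. upper_rate x < \<infinity>)"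
    and "bounded_partial_quotients \<alpha> \<Longrightarrow> AE x in M. lower_rate x < 1 \<and> upper_rate x > 1"
proof -
  interpret prob_space M using M by (simp add: invariant_prob_def)
  have sp: "space M = X" using M by (simp add: invariant_prob_def)
  note eq = bounded_partial_quotients_iff[OF \<alpha>(3)]
  show "bounded_partial_quotients \<alpha> \<longleftrightarrow> (AE x in M. lower_rate x > 0)"
  proof
    assume "bounded_partial_quotients \<alpha>"
    then show "AE x in M. lower_rate x > 0"
      using rates_badly_approximable(1) unfolding eq by (intro AE_I2) (simp add: sp)
  next
    assume pos: "AE x in M. lower_rate x > 0"
    show "bounded_partial_quotients \<alpha>"
    proof (rule ccontr)
      assume "\<not> bounded_partial_quotients \<alpha>"
      then have "AE x in M. lower_rate x \<le> 0" unfolding eq by (rule AE_lower_rate_eq_0[OF M])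
      with pos have "AE x in M. False" by eventually_elim auto
      then show False by simp
    qed
  qed
  show "bounded_partial_quotients \<alpha> \<longleftrightarrow> (AE x in M. upper_rate x < \<infinity>)"
  proof
    assume "bounded_partial_quotients \<alpha>"
    then show "AE x in M. upper_rate x < \<infinity>"
      using rates_badly_approximable(2) unfolding eq by (intro AE_I2) (simp add: sp)
  next
    assume fin: "AE x in M. upper_rate x < \<infinity>"
    show "bounded_partial_quotients \<alpha>"
    proof (rule ccontr)
      assume "\<not> bounded_partial_quotients \<alpha>"
      then have "AE x in M. upper_rate x = \<infinity>" unfolding eq by (rule AE_upper_rate_eq_PInfty[OF M])
      with fin have "AE x in M. False" by eventually_elim auto
      then show False by simp
    qed
  qed
  assume "bounded_partial_quotients \<alpha>"
  then show "AE x in M. lower_rate x < 1 \<and> upper_rate x > 1"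
    using AE_rates_badly_approximable[OF M] unfolding eq by auto
qed

end

section \<open>The rotation and the subshift\<close>

lemma rot_coding:
  assumes "0 < \<alpha>" "\<alpha> < 1" "\<alpha> \<notin> \<rat>"
  shows "sturmian_coding \<alpha> (rot \<alpha>) {0..<1} (rot_partition \<alpha>)
    (\<lambda>t i. sturm_ind \<alpha> (frac (t + real i * \<alpha>)))"
proof
  fix x y :: real and i :: nat
  show "rot \<alpha> x \<in> {0..<1}" by (simp add: rot_def frac_lt_1)
  show "sturm_ind \<alpha> (frac (rot \<alpha> x + real i * \<alpha>)) = sturm_ind \<alpha> (frac (x + real (Suc i) * \<alpha>))"
    by (simp add: rot_def algebra_simps)
  assume "x \<in> {0..<1}" "y \<in> {0..<1}"
  then show "(\<forall>A\<in>rot_partition \<alpha>. (y \<in> A) = (x \<in> A)) \<longleftrightarrow>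
      sturm_ind \<alpha> (frac (y + real 0 * \<alpha>)) = sturm_ind \<alpha> (frac (x + real 0 * \<alpha>))"
    using assms by (auto simp: rot_partition_def sturm_ind_def)
qed (use assms in auto)

text \<open>The rotation exchanges two intervals, translating each, so translation invariance of
  \<open>lborel\<close> applies piecewise.\<close>

lemma distr_rot:
  assumes "0 < \<alpha>" "\<alpha> < 1"
  defines "L \<equiv> restrict_space lborel {0..<1::real}"
  shows "rot \<alpha> \<in> measurable L L" "distr L L (rot \<alpha>) = L"
proof -
  have meas: "rot \<alpha> \<in> borel_measurable borel" unfolding rot_def frac_def by measurable
  show rotL: "rot \<alpha> \<in> measurable L L"
    unfolding L_def using meas
    by (intro measurable_restrict_space3) (auto simp: rot_def frac_lt_1)
  show "distr L L (rot \<alpha>) = L"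
  proof (rule measure_eqI)
    fix A assume "A \<in> sets (distr L L (rot \<alpha>))"
    then have A: "A \<in> sets borel" "A \<subseteq> {0..<1}" by (auto simp: L_def sets_restrict_space_iff)
    note [measurable] = A(1)
    \<comment> \<open>The rotation maps \<open>[0, 1 - \<alpha>)\<close> onto
      \<open>[\<alpha>, 1)\<close> and \<open>[1 - \<alpha>, 1)\<close> onto
      \<open>[0, \<alpha>)\<close>.\<close>
    define A1 A2 where "A1 = A \<inter> {\<alpha>..<1}" and "A2 = A \<inter> {0..<\<alpha>}"
    have A12[measurable]: "A1 \<in> sets borel" "A2 \<in> sets borel" by (auto simp: A1_def A2_def)
    have tr: "emeasure lborel ((\<lambda>x. t + x) -` B) = emeasure lborel B" if "B \<in> sets borel" for t :: real and B
    proof -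
      have "emeasure lborel B = emeasure (distr lborel borel ((+) t)) B"
        by (simp add: lborel_distr_plus)
      also have "\<dots> = emeasure lborel ((\<lambda>x. t + x) -` B)"
        using that by (subst emeasure_distr) auto
      finally show ?thesis by simp
    qed
    have rot_eq: "rot \<alpha> x = (if x < 1 - \<alpha> then \<alpha> + x else \<alpha> - 1 + x)" if "x \<in> {0..<1}" for x
      using that assms by (auto simp: rot_def frac_unique_iff)
    have "rot \<alpha> -` A \<inter> {0..<1} = ((\<lambda>x. \<alpha> + x) -` A1) \<union> ((\<lambda>x. \<alpha> - 1 + x) -` A2)"
      using A(2) assms by (auto simp: rot_eq A1_def A2_def split: if_splits)
    moreover have "emeasure lborel (((\<lambda>x. \<alpha> + x) -` A1) \<union> ((\<lambda>x. \<alpha> - 1 + x) -` A2))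
        = emeasure lborel ((\<lambda>x. \<alpha> + x) -` A1) + emeasure lborel ((\<lambda>x. \<alpha> - 1 + x) -` A2)"
      using A12 by (intro plus_emeasure[symmetric])
        (auto simp: A1_def A2_def intro!: measurable_sets_borel[of _ borel])
    moreover have "emeasure lborel A = emeasure lborel A1 + emeasure lborel A2"
    proof -
      have "A = A1 \<union> A2" using A(2) assms by (auto simp: A1_def A2_def)
      then have "emeasure lborel A = emeasure lborel (A1 \<union> A2)" by simp
      also have "\<dots> = emeasure lborel A1 + emeasure lborel A2"
        using A12 by (intro plus_emeasure[symmetric]) (auto simp: A1_def A2_def)
      finally show ?thesis .
    qed
    ultimately have "emeasure lborel (rot \<alpha> -` A \<inter> {0..<1}) = emeasure lborel A"
      using tr A12 by simp
    then show "emeasure (distr L L (rot \<alpha>)) A = emeasure L A"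
      using rotL A by (subst emeasure_distr)
        (auto simp: L_def emeasure_restrict_space sets_restrict_space_iff space_restrict_space)
  qed simp
qed

lemma rot_invariant:
  assumes "0 < \<alpha>" "\<alpha> < 1" "\<alpha> \<notin> \<rat>"
  shows "sturmian_coding.invariant_prob (rot \<alpha>) {0..<1} (\<lambda>t i. sturm_ind \<alpha> (frac (t + real i * \<alpha>)))
    (restrict_space lborel {0..<1})"
  unfolding sturmian_coding.invariant_prob_def[OF rot_coding[OF assms]]
proof (intro conjI allI)
  show "prob_space (restrict_space lborel {0..<1::real})"
    by (rule prob_space_restrict_space) auto
  fix i v
  have "{t. sturm_ind \<alpha> (frac (t + real i * \<alpha>)) = v} \<in> sets borel"
    unfolding sturm_ind_def frac_def by measurable
  then have "{0..<1} \<inter> {t. sturm_ind \<alpha> (frac (t + real i * \<alpha>)) = v} \<in> sets (restrict_space lborel {0..<1})"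
    unfolding sets_restrict_space by auto
  then show "{t \<in> {0..<1}. sturm_ind \<alpha> (frac (t + real i * \<alpha>)) = v} \<in> sets (restrict_space lborel {0..<1})"
    by (simp only: Int_def mem_Collect_eq)
qed (use distr_rot assms in \<open>auto simp: space_restrict_space\<close>)

section \<open>The Sturmian subshift as a closure of codings\<close>

lemma open_cylinder: "open {x :: int \<Rightarrow> nat. \<forall>i<n. x (int i) = u i}"
proof -
  have "open {x :: int \<Rightarrow> nat. x k = v}" for k v
  proof -
    have "open ((\<lambda>x :: int \<Rightarrow> nat. x k) -` {v})"
      using discrete_topology_class.open_discrete[of "{v}"] continuous_on_product_coordinates by (rule open_vimage)
    then show ?thesis by (simp add: vimage_def)
  qed
  then have "open (\<Inter>i\<in>{..<n}. {x :: int \<Rightarrow> nat. x (int i) = u i})" by (intro open_INT) auto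
  moreover have "(\<Inter>i\<in>{..<n}. {x :: int \<Rightarrow> nat. x (int i) = u i}) = {x. \<forall>i<n. x (int i) = u i}" by auto
  ultimately show ?thesis by simp
qed

text \<open>The cylinder of a finite prefix is an open neighbourhood, so a point of the closure
  shares that prefix with a genuine coding.\<close>

lemma sturm_space_coding:
  assumes "x \<in> sturm_space \<alpha>"
  shows "\<exists>t\<in>{0..<1}. \<forall>i<n. x (int i) = sturm_ind \<alpha> (frac (t + real i * \<alpha>))"
proof -
  have "sturm_code \<alpha> ` {0..<1} \<inter> {y. \<forall>i<n. y (int i) = x (int i)} \<noteq> {}"
    using assms open_cylinder[of n "\<lambda>i. x (int i)"]
    unfolding sturm_space_def closure_iff_nhds_not_empty by blast
  then show ?thesis by (force simp: sturm_code_def)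
qed

lemma shift_sturm_code: "shift (sturm_code \<alpha> t) = sturm_code \<alpha> (frac (t + \<alpha>))"
proof
  fix n
  have "frac (frac (t + \<alpha>) + of_int n * \<alpha>) = frac (t + of_int (n + 1) * \<alpha>)"
    by (simp add: algebra_simps)
  then show "shift (sturm_code \<alpha> t) n = sturm_code \<alpha> (frac (t + \<alpha>)) n"
    by (simp add: shift_def sturm_code_def)
qed

lemma shift_in_sturm_space:
  assumes "x \<in> sturm_space \<alpha>"
  shows "shift x \<in> sturm_space \<alpha>"
proof -
  have cont: "continuous_on UNIV shift"
    unfolding shift_def by (intro continuous_on_coordinatewise_then_product continuous_on_product_coordinates)
  have "shift ` closure (sturm_code \<alpha> ` {0..<1}) \<subseteq> sturm_space \<alpha>"
  proof (rule image_closure_subset)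
    show "continuous_on (closure (sturm_code \<alpha> ` {0..<1})) shift"
      using cont by (rule continuous_on_subset) simp
    show "closed (sturm_space \<alpha>)" by (simp add: sturm_space_def)
    have "shift ` sturm_code \<alpha> ` {0..<1} \<subseteq> sturm_code \<alpha> ` {0..<1}"
      by (auto simp: shift_sturm_code frac_lt_1)
    then show "shift ` sturm_code \<alpha> ` {0..<1} \<subseteq> sturm_space \<alpha>"
      unfolding sturm_space_def by (rule subset_trans[OF _ closure_subset])
  qed
  then show ?thesis using assms unfolding sturm_space_def by blast
qed

lemma shift_coding:
  assumes "0 < \<alpha>" "\<alpha> < 1" "\<alpha> \<notin> \<rat>"
  shows "sturmian_coding \<alpha> shift (sturm_space \<alpha>) (sturm_partition \<alpha>) (\<lambda>x i. x (int i))"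
proof (rule sturmian_coding.intro)
  show "shift x \<in> sturm_space \<alpha>" if "x \<in> sturm_space \<alpha>" for x
    using that by (rule shift_in_sturm_space)
  show "shift x (int i) = x (int (Suc i))" for x i
    by (simp only: shift_def of_nat_Suc add.commute)
  \<comment> \<open>The ambient alphabet is \<open>nat\<close>, and the partition sees only the
    letters 0 and 1; the closure must be shown to contain no other letter for it to determine
    \<open>z 0\<close>.\<close>
  have bin: "z 0 = 0 \<or> z 0 = 1" if z: "z \<in> sturm_space \<alpha>" for z
  proof -
    obtain t where "\<forall>i<1. z (int i) = sturm_ind \<alpha> (frac (t + real i * \<alpha>))"
      using sturm_space_coding[OF z, of 1] by (rule bexE)
    then have "z 0 = sturm_ind \<alpha> (frac t)" by simp
    then show ?thesis by (simp add: sturm_ind_def)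
  qed
  show "(\<forall>A\<in>sturm_partition \<alpha>. y \<in> A \<longleftrightarrow> x \<in> A) \<longleftrightarrow> y (int 0) = x (int 0)"
    if x: "x \<in> sturm_space \<alpha>" and y: "y \<in> sturm_space \<alpha>" for x y
  proof -
    have "(\<forall>A\<in>sturm_partition \<alpha>. y \<in> A \<longleftrightarrow> x \<in> A) \<longleftrightarrow>
        (y 0 = 0 \<longleftrightarrow> x 0 = 0) \<and> (y 0 = 1 \<longleftrightarrow> x 0 = 1)"
      using x y by (simp add: sturm_partition_def)
    also have "\<dots> \<longleftrightarrow> y 0 = x 0" using bin[OF x] bin[OF y] by (elim disjE) simp_all
    finally show ?thesis by (simp only: of_nat_0)
  qed
  show "\<exists>t\<in>{0..<1}. \<forall>i<n. x (int i) = sturm_ind \<alpha> (frac (t + real i * \<alpha>))"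
    if "x \<in> sturm_space \<alpha>" for x n
    using that by (rule sturm_space_coding)
  show "\<exists>x\<in>sturm_space \<alpha>. \<forall>i. x (int i) = sturm_ind \<alpha> (frac (t + real i * \<alpha>))"
    if "t \<in> {0..<1}" for t
  proof
    show "sturm_code \<alpha> t \<in> sturm_space \<alpha>"
      unfolding sturm_space_def by (rule closure_subset[THEN subsetD]) (rule imageI[OF that])
    show "\<forall>i. sturm_code \<alpha> t (int i) = sturm_ind \<alpha> (frac (t + real i * \<alpha>))"
      by (simp add: sturm_code_def)
  qed
qed (fact assms)+

lemma shift_invariant:
  assumes "0 < \<alpha>" "\<alpha> < 1" "\<alpha> \<notin> \<rat>" "sturm_inv_prob \<alpha> \<mu>"
  shows "sturmian_coding.invariant_prob shift (sturm_space \<alpha>) (\<lambda>x i. x (int i)) \<mu>"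
  unfolding sturmian_coding.invariant_prob_def[OF shift_coding[OF assms(1-3)]]
proof (intro conjI allI)
  fix i v
  have "(\<lambda>x :: int \<Rightarrow> nat. x (int i)) \<in> borel_measurable borel"
    by (intro borel_measurable_continuous_onI continuous_on_product_coordinates)
  then have "(\<lambda>x :: int \<Rightarrow> nat. x (int i)) -` {v} \<inter> space borel \<in> sets borel"
    by (rule measurable_sets) simp
  then have "{x :: int \<Rightarrow> nat. x (int i) = v} \<in> sets borel" by (simp add: vimage_def)
  then have "sturm_space \<alpha> \<inter> {x :: int \<Rightarrow> nat. x (int i) = v} \<in> sets (restrict_space borel (sturm_space \<alpha>))"
    unfolding sets_restrict_space by blast
  then show "{x \<in> sturm_space \<alpha>. x (int i) = v} \<in> sets \<mu>"
    using assms(4) by (simp add: sturm_inv_prob_def Int_def)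
qed (use assms(4) in \<open>auto simp: sturm_inv_prob_def\<close>)

theorem theorem1p3:
  fixes \<alpha> :: real
  assumes "0 < \<alpha>" and "\<alpha> < 1" and "\<alpha> \<notin> \<rat>"
  shows
   "(\<forall>\<mu>. sturm_inv_prob \<alpha> \<mu> \<longrightarrow>
       (bounded_partial_quotients \<alpha> \<longleftrightarrow>
          (AE x in \<mu>. lower_rec_rate shift (sturm_space \<alpha>) (sturm_partition \<alpha>) x > 0))
     \<and> (bounded_partial_quotients \<alpha> \<longleftrightarrow>
          (AE x in \<mu>. upper_rec_rate shift (sturm_space \<alpha>) (sturm_partition \<alpha>) x < \<infinity>))
     \<and> (bounded_partial_quotients \<alpha> \<longrightarrow>
          (AE x in \<mu>. lower_rec_rate shift (sturm_space \<alpha>) (sturm_partition \<alpha>) x < 1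
                    \<and> upper_rec_rate shift (sturm_space \<alpha>) (sturm_partition \<alpha>) x > 1)))
  \<and> (let L = restrict_space lborel {0..<1::real} in
       (bounded_partial_quotients \<alpha> \<longleftrightarrow>
          (AE t in L. lower_rec_rate (rot \<alpha>) {0..<1} (rot_partition \<alpha>) t > 0))
     \<and> (bounded_partial_quotients \<alpha> \<longleftrightarrow>
          (AE t in L. upper_rec_rate (rot \<alpha>) {0..<1} (rot_partition \<alpha>) t < \<infinity>))
     \<and> (bounded_partial_quotients \<alpha> \<longrightarrow>
          (AE t in L. lower_rec_rate (rot \<alpha>) {0..<1} (rot_partition \<alpha>) t < 1
                    \<and> upper_rec_rate (rot \<alpha>) {0..<1} (rot_partition \<alpha>) t > 1)))"
  unfolding Let_def
proof (intro conjI allI impI)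
  fix \<mu> assume \<mu>: "sturm_inv_prob \<alpha> \<mu>"
  note rates = sturmian_coding.recurrence_rates[OF shift_coding[OF assms] shift_invariant[OF assms \<mu>]]
  show "bounded_partial_quotients \<alpha> \<longleftrightarrow>
          (AE x in \<mu>. lower_rec_rate shift (sturm_space \<alpha>) (sturm_partition \<alpha>) x > 0)"
    by (rule rates(1))
  show "bounded_partial_quotients \<alpha> \<longleftrightarrow>
          (AE x in \<mu>. upper_rec_rate shift (sturm_space \<alpha>) (sturm_partition \<alpha>) x < \<infinity>)"
    by (rule rates(2))
  assume "bounded_partial_quotients \<alpha>"
  then show "AE x in \<mu>. lower_rec_rate shift (sturm_space \<alpha>) (sturm_partition \<alpha>) x < 1
                    \<and> upper_rec_rate shift (sturm_space \<alpha>) (sturm_partition \<alpha>) x > 1"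
    by (rule rates(3))
\<comment> \<open>The rotation claims are the same three facts for the other instance of the coding
  frame.\<close>
qed (fact sturmian_coding.recurrence_rates[OF rot_coding[OF assms] rot_invariant[OF assms]])+

end
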